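(* (i) Let $\beta\ge 0$ and let $\Lambda$ be a measure on $(0,\infty)$ such that $\int_0^\infty (1-\mathrm{e}^{-ux})\,\Lambda(dx)$ converges for some (and hence for all) $u>0$; equivalently, $\int_0^\infty \min\{x,1\}\,\Lambda(dx)<\infty$. Exclude the degenerate case $\Lambda=0$, which corresponds to the non-random line $S(t)=\beta t$. Then the function $$\Psi(u)=\beta u+\int_0^\infty (1-\mathrm{e}^{-ux})\,\Lambda(dx),\qquad u\ge 0,$$ is the Laplace exponent of some subordinator $S(t)$, $t\ge 0$, i.e. $\mathbb{E}\bigl[\mathrm{e}^{-uS(t)}\bigr]=\mathrm{e}^{-t\Psi(u)}$ for all $t\ge 0$ and $u\ge 0$. (ii) Conversely, any (non-degenerate) subordinator $S(t)$, $t\ge 0$, admits a representation $$\mathbb{E}\bigl[\mathrm{e}^{-uS(t)}\bigr]=\mathrm{e}^{-t\Psi(u)},\qquad \Psi(u)=\beta u+\int_0^\infty (1-\mathrm{e}^{-ux})\,\Lambda(dx),\qquad t\ge 0,\ u\ge 0,$$ where $\beta\ge 0$ and $\Lambda$ is a measure on $(0,\infty)$ such that the integral converges for some (and hence for all) $u>0$, and the drift $\beta$ and the L\'evy measure $\Lambda$ are uniquely determined.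
   Context: A stochastic process is a collection of random variables $S(t)=S(t,\omega)$, $\omega\in\Omega$, on a probability space $(\Omega,\mathcal{F},\mathbb{P})$, indexed by a real parameter $t\ge 0$. A subordinator is a real-valued (in particular finite-valued) stochastic process $S(t)$, $t\ge 0$, such that: (1) almost surely (that is, for all $\omega$ in some $\Omega'\subset\Omega$ with $\mathbb{P}(\Omega')=1$), $S(0)=0$, the trajectory is non-decreasing ($S(s)\le S(t)$ for all $0\le s\le t$), and it is right-continuous ($\lim_{t\downarrow s}S(t)=S(s)$ for every $s\ge 0$); (2) its increments are stationary: for any $0\le s\le t$ the distribution of $S(t)-S(s)$ depends only on $t-s$; (3) its increments are independent: for every $n$ and any $0=t_0\le t_1\le\dots\le t_n$, the random variables $S(t_1)-S(t_0),\,S(t_2)-S(t_1),\dots,S(t_n)-S(t_{n-1})$ are independent. Standing assumption: the degenerate case of a non-random line $S(t)=\beta t$, $\beta\ge 0$, is excluded, that is, for some (and hence for all) $t>0$ the random variable $S(t)$ has a non-degenerate distribution. The Laplace exponent of a subordinator $S$ is the function $\Psi$ on $[0,\infty)$ satisfying $\mathbb{E}[\mathrm{e}^{-uS(t)}]=\mathrm{e}^{-t\Psi(u)}$ for all $t\ge0$, $u\ge 0$. The number $\beta$ is called the drift coefficient and $\Lambda$ the L\'evy measure. *)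

theory Defs
  imports "HOL-Probability.Probability"
begin

text \<open>
  The process is a family of functions indexed by all of \<^typ>\<open>real\<close>; only its values at
  nonnegative times are constrained, and no property below looks at negative times.
\<close>

locale subordinator = prob_space M
  for M :: "'a measure" and S :: "real \<Rightarrow> 'a \<Rightarrow> real" +
  assumes measurable_process: "\<And>t. 0 \<le> t \<Longrightarrow> random_variable borel (S t)"
    and paths: "AE \<omega> in M.
          S 0 \<omega> = 0 \<and>
          (\<forall>s t. 0 \<le> s \<and> s \<le> t \<longrightarrow> S s \<omega> \<le> S t \<omega>) \<and>
          (\<forall>s\<ge>0. ((\<lambda>t. S t \<omega>) \<longlongrightarrow> S s \<omega>) (at_right s))"
    and stationary_increments:
        "\<And>s t s' t'. \<lbrakk>0 \<le> s; s \<le> t; 0 \<le> s'; s' \<le> t'; t - s = t' - s'\<rbrakk> \<Longrightarrow>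
          distr M borel (\<lambda>\<omega>. S t \<omega> - S s \<omega>) = distr M borel (\<lambda>\<omega>. S t' \<omega> - S s' \<omega>)"
    and independent_increments:
        "\<And>(n :: nat) \<tau>. \<lbrakk>\<tau> 0 = 0; \<And>i. i < n \<Longrightarrow> \<tau> i \<le> \<tau> (Suc i)\<rbrakk> \<Longrightarrow>
          indep_vars (\<lambda>_. borel) (\<lambda>i \<omega>. S (\<tau> (Suc i)) \<omega> - S (\<tau> i) \<omega>) {..<n}"

locale nondegenerate_subordinator = subordinator +
  assumes nondegenerate: "\<exists>t>0. \<not> (\<exists>c. AE \<omega> in M. S t \<omega> = c)"

definition is_laplace_exponent ::
    "'a measure \<Rightarrow> (real \<Rightarrow> 'a \<Rightarrow> real) \<Rightarrow> (real \<Rightarrow> real) \<Rightarrow> bool" where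
  "is_laplace_exponent M S \<Psi> \<longleftrightarrow>
     (\<forall>t\<ge>0. \<forall>u\<ge>0. (LINT \<omega>|M. exp (- u * S t \<omega>)) = exp (- t * \<Psi> u))"

text \<open>
  A measure on the open half-line is a Borel measure whose underlying space is the half-line
  itself, so that two such measures are equal as elements of the measure type exactly when they
  agree on all Borel subsets of the half-line.
\<close>

definition halfline_measure :: "real measure \<Rightarrow> bool" where
  "halfline_measure \<Lambda> \<longleftrightarrow> sets \<Lambda> = sets (restrict_space borel {0<..})"

definition levy_measure :: "real measure \<Rightarrow> bool" where
  "levy_measure \<Lambda> \<longleftrightarrow>
     halfline_measure \<Lambda> \<and> (\<exists>u>0. integrable \<Lambda> (\<lambda>x. 1 - exp (- u * x)))"

definition levy_khintchine :: "real \<Rightarrow> real measure \<Rightarrow> real \<Rightarrow> real" where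
  "levy_khintchine \<beta> \<Lambda> u = \<beta> * u + (LINT x|\<Lambda>. 1 - exp (- u * x))"

end

theory Submission
  imports Defs
begin

text \<open>
  Existence: let \<open>(\<tau>, x)\<close> run through a Poisson point process with intensity Lebesgue measure times
  \<open>\<Lambda>\<close>, and put \<open>S t = \<beta> t + (\<Sum> of the sizes x with 0 < \<tau> \<le> t)\<close>. Its Laplace functional gives the joint
  Laplace transform of the increments, and injectivity of the one-dimensional Laplace transform
  (Weierstrass approximation in \<open>exp (- x)\<close>) turns the product form of the latter into stationarity
  and independence.

  Representation: \<open>\<Psi> u / \<Psi> 1\<close> is the limit, as \<open>h\<close> tends to 0, of the integrals of
  \<open>(1 - exp (- u * x)) / (1 - exp (- x))\<close> against the law of \<open>S h\<close> with density proportional to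
  \<open>1 - exp (- x)\<close>. In the variable \<open>y = exp (- x)\<close> these laws live on \<open>[0, 1]\<close>, so Helly's theorem
  provides a limit law; its atom at \<open>y = 1\<close> is the drift, there is none at \<open>y = 0\<close> because \<open>\<Psi>\<close>
  vanishes at 0 continuously, and the rest is \<open>\<Lambda>\<close>.

  Uniqueness: \<open>\<Psi> (u + 1) - \<Psi> u\<close> is the Laplace transform of the finite measure consisting of
  \<open>(1 - exp (- x)) \<Lambda>(dx)\<close> and an atom \<open>\<beta>\<close> at 0.
\<close>

section \<open>Integrability and Laplace transforms\<close>

text \<open>When \<Lambda> is infinite, jumps of arbitrarily small size accumulate in every time
  interval of positive length, so the point process is not a finite random sample. It is built as an
  independent superposition of finite processes over countably many cells of finite intensity. Sums
  over points take values in [0, \<infinity>], with exp (- x) extended by 0 at infinity: the Laplace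
  functional then needs no convergence hypothesis, and finiteness of the sums is itself read off
  from it by letting the argument tend to 0.

  In the converse direction the law of S h scaled by 1/h, which should approximate \<Lambda>, has
  total mass 1/h. The weight \<open>1 - exp (- x)\<close> tames this mass, being comparable with
  \<open>min x 1\<close>; its normalising constant is h times \<Psi> 1 to first order. The compact
  interval [0, 1] prevents mass from escaping; the price is that mass may settle at both ends, small
  jumps merging into a drift at one end and jumps running off to infinity at the other.\<close>

lemma halfline_measure_space:
  assumes "halfline_measure \<Lambda>"
  shows "space \<Lambda> = {0<..}"
  using sets_eq_imp_space_eq[of \<Lambda> "restrict_space borel {0<..}"] assms
  by (simp add: halfline_measure_def space_restrict_space)

lemma halfline_measure_measurable:
  assumes "halfline_measure \<Lambda>" "f \<in> borel_measurable borel"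
  shows "f \<in> borel_measurable \<Lambda>"
proof -
  have "f \<in> borel_measurable (restrict_space borel {0<..})"
    using assms(2) by (rule measurable_restrict_space1)
  also have "borel_measurable (restrict_space borel {0<..}) = borel_measurable \<Lambda>"
    using assms(1) unfolding halfline_measure_def by (intro measurable_cong_sets) auto
  finally show ?thesis .
qed

lemma one_minus_exp_le:
  fixes x u :: real assumes "0 \<le> x" "0 \<le> u"
  shows "1 - exp (- u * x) \<le> max u 1 * min x 1"
proof (cases "x \<le> 1")
  case True
  have "1 - exp (- u * x) \<le> u * x" using exp_ge_add_one_self[of "-u*x"] by linarith
  also have "\<dots> \<le> max u 1 * x" using assms by (intro mult_right_mono) auto
  finally show ?thesis using True by (simp add: min_def)
next
  case False
  have "1 - exp (- u * x) \<le> 1" by simp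
  also have "\<dots> \<le> max u 1" by simp
  finally show ?thesis using False by simp
qed

text \<open>On [0, 1] the concave function \<open>1 - exp (- u * x)\<close> of x lies above its
  chord, which has slope \<open>1 - exp (- u)\<close>; past 1 it does not decrease while
  \<open>min x 1\<close> stays at 1.\<close>

lemma one_minus_exp_ge:
  fixes x u :: real assumes "0 \<le> x" "0 \<le> u"
  shows "(1 - exp (- u)) * min x 1 \<le> 1 - exp (- u * x)"
proof (cases "x \<le> 1")
  case True
  have "convex_on UNIV (exp :: real \<Rightarrow> real)" by (rule exp_convex)
  from convex_onD[OF this, of x 0 "-u"] True assms
  have "exp (- u * x) \<le> (1 - x) * 1 + x * exp (- u)" by (simp add: mult.commute)
  then show ?thesis using True by (simp add: min_def algebra_simps)
next
  case False
  have "exp (- u * x) \<le> exp (- u * 1)"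
    using mult_left_mono[of 1 x u] False assms by simp
  then show ?thesis using False by simp
qed

text \<open>The comparison function \<open>min x 1\<close> does not involve u, so it carries
  integrability from one u to every other.\<close>

lemma integrable_one_minus_exp_iff:
  assumes L: "halfline_measure \<Lambda>" and u: "0 < u"
  shows "integrable \<Lambda> (\<lambda>x. 1 - exp (- u * x)) \<longleftrightarrow> integrable \<Lambda> (\<lambda>x. min x 1)"
proof
  note [measurable] = halfline_measure_measurable[OF L]
  have pos: "0 < 1 - exp (-u)" using u by simp
  assume "integrable \<Lambda> (\<lambda>x. 1 - exp (- u * x))"
  then have I: "integrable \<Lambda> (\<lambda>x. (1 / (1 - exp (-u))) * (1 - exp (- u * x)))"
    by (rule integrable_mult_right)
  show "integrable \<Lambda> (\<lambda>x. min x 1)"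
  proof (rule Bochner_Integration.integrable_bound[OF I])
    show "(\<lambda>x. min x 1) \<in> borel_measurable \<Lambda>" by measurable
    show "AE x in \<Lambda>. norm (min x 1) \<le> norm (1 / (1 - exp (- u)) * (1 - exp (- u * x)))"
    proof (rule AE_I2)
      fix x assume "x \<in> space \<Lambda>"
      then have x: "0 < x" using halfline_measure_space[OF L] by simp
      have "(1 - exp (- u)) * min x 1 \<le> 1 - exp (- u * x)"
        using one_minus_exp_ge[of x u] x u by simp
      then have "min x 1 \<le> 1 / (1 - exp (- u)) * (1 - exp (- u * x))"
        using pos by (simp add: field_simps)
      then show "norm (min x 1) \<le> norm (1 / (1 - exp (- u)) * (1 - exp (- u * x)))"
        using x unfolding real_norm_def by (intro order_trans[OF _ abs_ge_self]) simp
    qed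
  qed
next
  note [measurable] = halfline_measure_measurable[OF L]
  assume "integrable \<Lambda> (\<lambda>x. min x 1)"
  then have I: "integrable \<Lambda> (\<lambda>x. max u 1 * min x 1)"
    by (rule integrable_mult_right)
  show "integrable \<Lambda> (\<lambda>x. 1 - exp (- u * x))"
  proof (rule Bochner_Integration.integrable_bound[OF I])
    show "(\<lambda>x. 1 - exp (- u * x)) \<in> borel_measurable \<Lambda>" by measurable
    show "AE x in \<Lambda>. norm (1 - exp (- u * x)) \<le> norm (max u 1 * min x 1)"
    proof (rule AE_I2)
      fix x assume "x \<in> space \<Lambda>"
      then have x: "0 < x" using halfline_measure_space[OF L] by simp
      then have "0 < u * x" using u by simp
      then show "norm (1 - exp (- u * x)) \<le> norm (max u 1 * min x 1)"
        using one_minus_exp_le[of x u] x u by auto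
    qed
  qed
qed

lemma levy_measureD:
  assumes "levy_measure \<Lambda>"
  shows "halfline_measure \<Lambda>" "integrable \<Lambda> (\<lambda>x. min x 1)"
    and "\<And>u. 0 \<le> u \<Longrightarrow> integrable \<Lambda> (\<lambda>x. 1 - exp (- u * x))"
proof -
  show L: "halfline_measure \<Lambda>" using assms by (simp add: levy_measure_def)
  show I: "integrable \<Lambda> (\<lambda>x. min x 1)"
    using assms integrable_one_minus_exp_iff[OF L] by (auto simp: levy_measure_def)
  fix u :: real assume "0 \<le> u"
  then show "integrable \<Lambda> (\<lambda>x. 1 - exp (- u * x))"
    using I integrable_one_minus_exp_iff[OF L, of u] by (cases "u = 0") auto
qed

lemma integrable_bounded_AE:
  fixes f :: "'a \<Rightarrow> real"
  assumes "finite_measure M" "f \<in> borel_measurable M" "AE x in M. \<bar>f x\<bar> \<le> B"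
  shows "integrable M f"
  using finite_measure.integrable_const_bound[OF assms(1), of f B] assms by simp

section \<open>Uniqueness for moments and Laplace transforms\<close>

text \<open>By Weierstrass, polynomials are uniformly dense in the continuous functions on [0, 1],
  so equal moments force equal integrals of continuous functions; these approximate the indicators
  of the half-lines \<open>{a<..}\<close>, which determine a finite measure.\<close>

lemma moments_unique:
  fixes M N :: "real measure"
  assumes M: "finite_measure M" "sets M = sets borel" "AE x in M. x \<in> {0..1}"
    and N: "finite_measure N" "sets N = sets borel" "AE x in N. x \<in> {0..1}"
    and eq: "\<And>n::nat. (LINT x|M. x ^ n) = (LINT x|N. x ^ n)"
  shows "M = N"
proof -
  have [measurable_cong]: "sets M = sets borel" "sets N = sets borel" by fact+
  have cont: "(LINT x|M. f x) = (LINT x|N. f x)" if f: "continuous_on UNIV f" for f :: "real \<Rightarrow> real"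
  proof -
    have [measurable]: "f \<in> borel_measurable borel"
      using f by (rule borel_measurable_continuous_onI)
    have f01: "continuous_on {0..1} f" using f continuous_on_subset by blast
    then have "bounded (f ` {0..1})"
      by (intro compact_imp_bounded compact_continuous_image) auto
    then obtain B where "\<forall>y\<in>f ` {0..1}. norm y \<le> B"
      unfolding bounded_iff by blast
    then have B: "\<bar>f x\<bar> \<le> B" if "x \<in> {0..1}" for x
      using that by (simp del: atLeastAtMost_iff)
    have intf: "integrable M f" "integrable N f"
      by (rule integrable_bounded_AE[where B=B, OF M(1) _ eventually_mono[OF M(3) B]]; simp)
        (rule integrable_bounded_AE[where B=B, OF N(1) _ eventually_mono[OF N(3) B]]; simp)
    have pow: "integrable M (\<lambda>x. x ^ n)" "integrable N (\<lambda>x. x ^ n)" for n :: nat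
      by (rule integrable_bounded_AE[where B=1, OF M(1) _ eventually_mono[OF M(3)]]; simp add: power_le_one)
        (rule integrable_bounded_AE[where B=1, OF N(1) _ eventually_mono[OF N(3)]]; simp add: power_le_one)
    \<comment> \<open>The approximation error e enters once for each measure, weighted by its total
      mass; since the masses are finite, e may tend to 0.\<close>
    have le: "\<bar>(LINT x|M. f x) - (LINT x|N. f x)\<bar> \<le> 0 + e * (measure M UNIV + measure N UNIV)"
      if e: "0 < e" for e
    proof -
      obtain p where p: "real_polynomial_function p" "\<And>x. x \<in> {0..1} \<Longrightarrow> \<bar>f x - p x\<bar> < e"
        using Stone_Weierstrass_real_polynomial_function[OF _ f01 e] by auto
      then obtain a n where p_eq: "p = (\<lambda>x. \<Sum>i\<le>n. a i * x ^ i)"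
        using real_polynomial_function_iff_sum by blast
      have intp: "integrable M p" "integrable N p"
        unfolding p_eq using pow by auto
      have "(LINT x|M. p x) = (LINT x|N. p x)"
        unfolding p_eq using pow eq by (simp add: Bochner_Integration.integral_sum)
      moreover have "\<bar>(LINT x|K. f x) - (LINT x|K. p x)\<bar> \<le> e * measure K UNIV"
        if "K = M \<or> K = N" for K
      proof -
        interpret finite_measure K using that M N by auto
        have sp: "space K = UNIV"
          using that sets_eq_imp_space_eq[OF M(2)] sets_eq_imp_space_eq[OF N(2)] by auto
        have i: "integrable K f" "integrable K p" using that intf intp by auto
        have AE: "AE x in K. x \<in> {0..1}" using that M N by auto
        have "\<bar>(LINT x|K. f x) - (LINT x|K. p x)\<bar> = \<bar>LINT x|K. f x - p x\<bar>"
          using i by simp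
        also have "\<dots> \<le> (LINT x|K. \<bar>f x - p x\<bar>)" by (rule integral_abs_bound)
        also have "\<dots> \<le> (LINT x|K. e)"
        proof (rule integral_mono_AE)
          show "AE x in K. \<bar>f x - p x\<bar> \<le> e"
            using AE by (rule eventually_mono) (rule less_imp_le[OF p(2)])
        qed (use i in auto)
        finally show ?thesis by (simp add: sp mult.commute)
      qed
      from this[of M] this[of N] calculation show ?thesis by (simp add: algebra_simps)
    qed
    have "((\<lambda>e. 0 + e * (measure M UNIV + measure N UNIV)) \<longlongrightarrow> 0 + 0 * (measure M UNIV + measure N UNIV)) (at_right 0)"
      by (intro tendsto_intros)
    from tendsto_lowerbound[OF this, of "\<bar>(LINT x|M. f x) - (LINT x|N. f x)\<bar>"] le
    show ?thesis by (auto simp: eventually_at_right_less eventually_at_filter)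
  qed
  \<comment> \<open>Continuous ramps that increase to the indicator of \<open>{a<..}\<close> as n
    grows.\<close>
  define g where "g a n x = min 1 (real n * max 0 (x - a))" for a :: real and n :: nat and x :: real
  have lim: "(\<lambda>n. LINT x|K. g a n x) \<longlonglongrightarrow> measure K {a<..}"
    if K: "finite_measure K" "sets K = sets borel" for K and a :: real
  proof -
    have [measurable_cong]: "sets K = sets borel" by fact
    interpret finite_measure K by fact
    have "(\<lambda>n. LINT x|K. g a n x) \<longlonglongrightarrow> (LINT x|K. indicator {a<..} x)"
    proof (rule integral_dominated_convergence[where w="\<lambda>_. 1"])
      show "AE x in K. (\<lambda>n. g a n x) \<longlonglongrightarrow> indicator {a<..} x"
      proof (rule AE_I2)
        fix x
        show "(\<lambda>n. g a n x) \<longlonglongrightarrow> indicator {a<..} x"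
        proof (cases "a < x")
          case True
          obtain m :: nat where m: "1 < real m * (x - a)"
            using True ex_less_of_nat_mult[of "x - a" 1] by auto
          have "eventually (\<lambda>n. g a n x = 1) sequentially"
            using eventually_ge_at_top[of m]
          proof eventually_elim
            case (elim n)
            then have "real m * (x - a) \<le> real n * (x - a)" using True by (intro mult_right_mono) auto
            with m have "1 < real n * (x - a)" by linarith
            then show ?case using True by (simp add: g_def min_def max_def)
          qed
          then show ?thesis using True by (simp add: tendsto_eventually)
        qed (simp add: g_def)
      qed
    qed (auto simp: g_def)
    then show ?thesis using sets_eq_imp_space_eq[OF K(2)] by simp
  qed
  show ?thesis
  proof (rule measure_eqI_lessThan)
    fix x :: real
    interpret M: finite_measure M by fact
    interpret N: finite_measure N by fact
    show "emeasure M {x<..} < \<infinity>" using M.emeasure_finite[of "{x<..}"] by (simp add: less_top[symmetric])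
    have "(\<lambda>n. LINT y|M. g x n y) = (\<lambda>n. LINT y|N. g x n y)"
      unfolding g_def by (intro ext cont continuous_intros)
    then have "measure M {x<..} = measure N {x<..}"
      using lim[OF M(1,2), of x] lim[OF N(1,2), of x] by (auto intro: LIMSEQ_unique)
    then show "emeasure M {x<..} = emeasure N {x<..}"
      by (simp add: M.emeasure_eq_measure N.emeasure_eq_measure)
  qed fact+
qed

text \<open>Under \<open>exp (- x)\<close> the half-line becomes (0, 1] and the transform at an
  integer n becomes the n-th moment of the image, so \<open>moments_unique\<close> applies;
  \<open>- ln y\<close> inverts the map.\<close>

lemma laplace_unique:
  fixes M N :: "real measure"
  assumes M: "finite_measure M" "sets M = sets borel" "AE x in M. 0 \<le> x"
    and N: "finite_measure N" "sets N = sets borel" "AE x in N. 0 \<le> x"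
    and eq: "\<And>u. 0 \<le> u \<Longrightarrow> (LINT x|M. exp (- u * x)) = (LINT x|N. exp (- u * x))"
  shows "M = N"
proof -
  have [measurable_cong]: "sets M = sets borel" "sets N = sets borel" by fact+
  define T :: "real \<Rightarrow> real" where "T x = exp (- x)" for x
  have [measurable]: "T \<in> borel_measurable borel" unfolding T_def by measurable
  have "distr M borel T = distr N borel T"
  proof (rule moments_unique)
    show "finite_measure (distr M borel T)" "finite_measure (distr N borel T)"
      using M(1) N(1) by (auto intro!: finite_measure.finite_measure_distr)
    show "AE x in distr M borel T. x \<in> {0..1}" "AE x in distr N borel T. x \<in> {0..1}"
      using M(3) N(3) by (simp_all add: AE_distr_iff T_def)
    show "(LINT x|distr M borel T. x ^ n) = (LINT x|distr N borel T. x ^ n)" for n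
      using eq[of "real n"] by (simp add: integral_distr T_def exp_of_nat_mult[symmetric])
  qed auto
  then have "distr (distr M borel T) borel (\<lambda>y. - ln y) = distr (distr N borel T) borel (\<lambda>y. - ln y)"
    by simp
  then have "distr M borel (\<lambda>x. x) = distr N borel (\<lambda>x. x)"
    by (simp add: distr_distr comp_def T_def)
  moreover have "distr M borel (\<lambda>x. x) = M" "distr N borel (\<lambda>x. x) = N"
    using M(2) N(2) by (auto intro!: distr_id2)
  ultimately show ?thesis by simp
qed

section \<open>Independence from factorised Laplace transforms\<close>

text \<open>The hypothesis equates the Laplace transforms of two finite measures, the laws of Y
  under the weights W and c; uniqueness of the transform upgrades exponentials to arbitrary Borel
  sets.\<close>

lemma (in prob_space) laplace_factor_indicator:
  fixes W Y :: "'a \<Rightarrow> real"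
  assumes W: "integrable M W" "\<And>\<omega>. 0 \<le> W \<omega>"
    and Y: "random_variable borel Y" "AE \<omega> in M. 0 \<le> Y \<omega>"
    and c: "0 \<le> c"
    and eq: "\<And>u. 0 \<le> u \<Longrightarrow> (LINT \<omega>|M. W \<omega> * exp (- u * Y \<omega>)) = c * (LINT \<omega>|M. exp (- u * Y \<omega>))"
    and A: "A \<in> sets borel"
  shows "(LINT \<omega>|M. W \<omega> * indicator A (Y \<omega>)) = c * (LINT \<omega>|M. indicator A (Y \<omega>))"
proof -
  note [measurable] = Y(1) A
  have [measurable]: "W \<in> borel_measurable M" using W(1) by auto
  let ?M = "distr (density M W) borel Y" and ?N = "distr (density M (\<lambda>_. ennreal c)) borel Y"
  have int: "(LINT x|?M. f x) = (LINT \<omega>|M. W \<omega> * f (Y \<omega>))"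
       "(LINT x|?N. f x) = c * (LINT \<omega>|M. f (Y \<omega>))"
    if [measurable]: "f \<in> borel_measurable borel" for f :: "real \<Rightarrow> real"
    using W(2) c by (simp_all add: integral_distr integral_density)
  have "?M = ?N"
  proof (rule laplace_unique)
    have "integral\<^sup>N M W < \<infinity>" using W by (simp add: nn_integral_eq_integral)
    then have "finite_measure (density M W)"
      by (intro finite_measureI) (simp add: emeasure_density nn_integral_eq_integral[OF W(1)] W(2) cong: nn_integral_cong)
    then show "finite_measure ?M" by (rule finite_measure.finite_measure_distr) simp
    have "finite_measure (density M (\<lambda>_. ennreal c))"
      by (intro finite_measureI) (simp add: emeasure_density emeasure_space_1 cong: nn_integral_cong)
    then show "finite_measure ?N" by (rule finite_measure.finite_measure_distr) simp
    show "AE x in ?M. 0 \<le> x" "AE x in ?N. 0 \<le> x"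
      using Y(2) by (auto simp: AE_distr_iff AE_density elim: eventually_mono)
    show "(LINT x|?M. exp (- u * x)) = (LINT x|?N. exp (- u * x))" if "0 \<le> u" for u
      proof -
      have "(\<lambda>x. exp (- u * x)) \<in> borel_measurable borel" by measurable
      from int[OF this] show ?thesis by (simp only: eq[OF that])
    qed
  qed auto
  then have "(LINT x|?M. indicator A x) = (LINT x|?N. (indicator A x :: real))" by simp
  then show ?thesis by (simp only: int[OF borel_measurable_indicator[OF A]])
qed

text \<open>Treating one coordinate at a time reduces the multivariate statement to uniqueness on
  the line: the other coordinates are frozen into a nonnegative weight.\<close>

lemma (in prob_space) indep_vars_laplace:
  fixes X :: "'i \<Rightarrow> 'a \<Rightarrow> real"
  assumes I: "finite I"
    and X: "\<And>i. i \<in> I \<Longrightarrow> random_variable borel (X i)" "\<And>i. i \<in> I \<Longrightarrow> AE \<omega> in M. 0 \<le> X i \<omega>"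
    and eq: "\<And>u. (\<And>i. i \<in> I \<Longrightarrow> 0 \<le> u i) \<Longrightarrow>
      (LINT \<omega>|M. (\<Prod>i\<in>I. exp (- u i * X i \<omega>))) = (\<Prod>i\<in>I. LINT \<omega>|M. exp (- u i * X i \<omega>))"
  shows "indep_vars (\<lambda>_. borel) X I"
proof -
  \<comment> \<open>exchange the exponentials for indicators one coordinate at a time\<close>
  have key: "K \<subseteq> I \<Longrightarrow> (\<And>i. i \<in> I \<Longrightarrow> 0 \<le> u i) \<Longrightarrow> (\<And>i. i \<in> I \<Longrightarrow> A i \<in> sets borel) \<Longrightarrow>
      (LINT \<omega>|M. (\<Prod>i\<in>K. indicator (A i) (X i \<omega>)) * (\<Prod>i\<in>I - K. exp (- u i * X i \<omega>)))
      = (\<Prod>i\<in>K. LINT \<omega>|M. indicator (A i) (X i \<omega>)) * (\<Prod>i\<in>I - K. LINT \<omega>|M. exp (- u i * X i \<omega>))"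
    if "finite K" for K u and A :: "'i \<Rightarrow> real set"
    using that
  proof (induction K arbitrary: u)
    case empty
    then show ?case using eq by simp
  next
    case (insert j K)
    then have j: "j \<in> I" "j \<notin> K" and K: "K \<subseteq> I" by auto
    note [measurable] = X(1) insert.prems(3)
    have meas: "i \<in> K \<Longrightarrow> random_variable borel (X i)" "i \<in> K \<Longrightarrow> A i \<in> sets borel"
      "i \<in> I - insert j K \<Longrightarrow> random_variable borel (X i)" for i
      using K X(1) insert.prems(3) by auto
    have IK: "I - K = insert j (I - insert j K)" using j by auto
    \<comment> \<open>W collects all factors except that of j, and c is the expectation that the
      induction hypothesis predicts for W; moving only the j-th argument then gives the assumption
      of \<open>laplace_factor_indicator\<close>.\<close>
    define W where "W \<omega> = (\<Prod>i\<in>K. indicator (A i) (X i \<omega>)) * (\<Prod>i\<in>I - insert j K. exp (- u i * X i \<omega>))" for \<omega>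
    define c where "c = (\<Prod>i\<in>K. LINT \<omega>|M. indicator (A i) (X i \<omega>)) * (\<Prod>i\<in>I - insert j K. LINT \<omega>|M. exp (- u i * X i \<omega>))"
    have [measurable]: "random_variable borel W"
      unfolding W_def
    proof (intro borel_measurable_times borel_measurable_prod)
      fix i assume i: "i \<in> K"
      note [measurable] = meas(1,2)[OF i]
      show "(\<lambda>\<omega>. indicator (A i) (X i \<omega>) :: real) \<in> borel_measurable M" by measurable
    next
      fix i assume i: "i \<in> I - insert j K"
      note [measurable] = meas(3)[OF i]
      show "(\<lambda>\<omega>. exp (- u i * X i \<omega>)) \<in> borel_measurable M" by measurable
    qed
    have AE0: "AE \<omega> in M. \<forall>i\<in>I. 0 \<le> X i \<omega>"
      using X(2) I by (simp add: AE_finite_all)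
    have W_int: "integrable M W"
    proof (rule integrable_const_bound[where B=1])
      show "AE \<omega> in M. norm (W \<omega>) \<le> 1"
        using AE0
      proof eventually_elim
        case (elim \<omega>)
        have "(\<Prod>i\<in>K. indicator (A i) (X i \<omega>) :: real) \<le> 1"
          by (rule prod_le_1) (simp add: indicator_def)
        moreover have "(\<Prod>i\<in>I - insert j K. exp (- u i * X i \<omega>)) \<le> 1"
          using elim insert.prems(2) by (intro prod_le_1) auto
        ultimately show ?case
          unfolding W_def by (auto simp: abs_mult prod_nonneg intro!: mult_le_one)
      qed
    qed simp
    have "(LINT \<omega>|M. W \<omega> * indicator (A j) (X j \<omega>)) = c * (LINT \<omega>|M. indicator (A j) (X j \<omega>))"
    proof (rule laplace_factor_indicator)
      show "0 \<le> W \<omega>" for \<omega> unfolding W_def by (intro mult_nonneg_nonneg prod_nonneg) auto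
      show "0 \<le> c" unfolding c_def by (intro mult_nonneg_nonneg prod_nonneg) auto
      fix v :: real assume v: "0 \<le> v"
      have "(LINT \<omega>|M. (\<Prod>i\<in>K. indicator (A i) (X i \<omega>)) * (\<Prod>i\<in>I - K. exp (- (u(j := v)) i * X i \<omega>)))
        = (\<Prod>i\<in>K. LINT \<omega>|M. indicator (A i) (X i \<omega>)) * (\<Prod>i\<in>I - K. LINT \<omega>|M. exp (- (u(j := v)) i * X i \<omega>))"
        using v insert.prems by (intro insert.IH) auto
      moreover have "(\<Prod>i\<in>I - K. exp (- (u(j := v)) i * X i \<omega>))
          = exp (- v * X j \<omega>) * (\<Prod>i\<in>I - insert j K. exp (- u i * X i \<omega>))" for \<omega>
        unfolding IK using I by (subst prod.insert) (auto intro!: prod.cong)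
      moreover have "(\<Prod>i\<in>I - K. LINT \<omega>|M. exp (- (u(j := v)) i * X i \<omega>))
          = (LINT \<omega>|M. exp (- v * X j \<omega>)) * (\<Prod>i\<in>I - insert j K. LINT \<omega>|M. exp (- u i * X i \<omega>))"
        unfolding IK using I by (subst prod.insert) (auto intro!: prod.cong)
      ultimately show "(LINT \<omega>|M. W \<omega> * exp (- v * X j \<omega>)) = c * (LINT \<omega>|M. exp (- v * X j \<omega>))"
        unfolding W_def c_def by (simp add: mult_ac)
    qed (use W_int X j insert.prems in auto)
    then show ?case
      unfolding W_def c_def using insert.hyps by (simp add: mult_ac)
  qed
  have prob: "(LINT \<omega>|M. indicator B (X i \<omega>)) = prob (X i -` B \<inter> space M)"
    if "i \<in> I" "B \<in> sets borel" for i B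
  proof -
    note [measurable] = X(1)[OF that(1)] that(2)
    have "(LINT \<omega>|M. indicator B (X i \<omega>)) = (LINT \<omega>|M. indicator (X i -` B \<inter> space M) \<omega> :: real)"
      by (intro Bochner_Integration.integral_cong) (auto simp: indicator_def)
    then show ?thesis by (simp add: Int_absorb2)
  qed
  show ?thesis
    unfolding indep_vars_def2 indep_sets_def
  proof (intro conjI ballI allI impI)
    fix i assume "i \<in> I" then show "random_variable borel (X i)" by (rule X)
  next
    fix i assume "i \<in> I" then show "{X i -` A \<inter> space M |A. A \<in> sets borel} \<subseteq> events"
      using X(1) by (auto intro: measurable_sets)
  next
    fix J A assume J: "J \<subseteq> I" "J \<noteq> {}" "finite J" and A: "A \<in> (\<Pi> i\<in>J. {X i -` A \<inter> space M |A. A \<in> sets borel})"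
    then have "\<forall>i\<in>J. \<exists>B. A i = X i -` B \<inter> space M \<and> B \<in> sets borel" by auto
    then obtain B where B: "\<And>i. i \<in> J \<Longrightarrow> A i = X i -` B i \<inter> space M" "\<And>i. i \<in> J \<Longrightarrow> B i \<in> sets borel"
      by metis
    \<comment> \<open>\<open>key\<close> asks for a Borel set at every index of I, so the family is
      filled up with the empty set outside J; the argument 0 turns the exponentials of those indices
      into 1.\<close>
    have Bm: "(if i \<in> J then B i else {}) \<in> sets borel" for i using B by auto
    have "(LINT \<omega>|M. (\<Prod>i\<in>J. indicator (B i) (X i \<omega>))) = (\<Prod>i\<in>J. LINT \<omega>|M. (indicator (B i) (X i \<omega>) :: real))"
      using key[OF J(3,1), of "\<lambda>_. 0" "\<lambda>i. if i \<in> J then B i else {}"] Bm by (simp add: prob_space)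
    moreover have "(LINT \<omega>|M. (\<Prod>i\<in>J. indicator (B i) (X i \<omega>))) = (LINT \<omega>|M. indicator (\<Inter>i\<in>J. A i) \<omega> :: real)"
    proof (intro Bochner_Integration.integral_cong refl)
      fix \<omega> assume "\<omega> \<in> space M"
      then have "(\<Prod>i\<in>J. indicator (B i) (X i \<omega>)) = (\<Prod>i\<in>J. indicator (A i) \<omega> :: real)"
        using B(1) by (intro prod.cong) (auto simp: indicator_def)
      also have "\<dots> = indicator (\<Inter>i\<in>J. A i) \<omega>"
        using J by (auto simp: indicator_def)
      finally show "(\<Prod>i\<in>J. indicator (B i) (X i \<omega>)) = (indicator (\<Inter>i\<in>J. A i) \<omega> :: real)" .
    qed
    moreover have "(\<Inter>i\<in>J. A i) \<inter> space M = (\<Inter>i\<in>J. A i)" using J B by auto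
    ultimately show "prob (\<Inter> (A ` J)) = (\<Prod>i\<in>J. prob (A i))"
      using B prob J by (simp add: subset_iff)
  qed
qed

text \<open>Besides the path properties, the joint transform of the increments is the only input
  from the construction: the marginal transforms are read off from it, and uniqueness turns them
  into stationarity and independence.\<close>

lemma subordinatorI_laplace:
  fixes S :: "real \<Rightarrow> 'a \<Rightarrow> real"
  assumes "prob_space M"
    and meas: "\<And>t. 0 \<le> t \<Longrightarrow> S t \<in> borel_measurable M"
    and paths: "AE \<omega> in M.
          S 0 \<omega> = 0 \<and>
          (\<forall>s t. 0 \<le> s \<and> s \<le> t \<longrightarrow> S s \<omega> \<le> S t \<omega>) \<and>
          (\<forall>s\<ge>0. ((\<lambda>t. S t \<omega>) \<longlongrightarrow> S s \<omega>) (at_right s))"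
    and laplace: "\<And>(n::nat) \<tau> u. \<tau> 0 = 0 \<Longrightarrow> (\<And>i. i < n \<Longrightarrow> \<tau> i \<le> \<tau> (Suc i)) \<Longrightarrow> (\<And>i. i < n \<Longrightarrow> 0 \<le> u i) \<Longrightarrow>
      (LINT \<omega>|M. (\<Prod>i<n. exp (- u i * (S (\<tau> (Suc i)) \<omega> - S (\<tau> i) \<omega>))))
      = (\<Prod>i<n. exp (- (\<tau> (Suc i) - \<tau> i) * \<Psi> (u i)))"
  shows "subordinator M S" and "is_laplace_exponent M S \<Psi>"
proof -
  interpret prob_space M by fact
  have \<Psi>0: "\<Psi> 0 = 0"
    using laplace[of "\<lambda>i. real i" 1 "\<lambda>_. 0"] by (simp add: prob_space)
  \<comment> \<open>Partition 0, s, t with weight 0 on the first interval, whose factor is 1 because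
    \<open>\<Psi> 0 = 0\<close>.\<close>
  have incr: "(LINT \<omega>|M. exp (- u * (S t \<omega> - S s \<omega>))) = exp (- (t - s) * \<Psi> u)"
    if "0 \<le> s" "s \<le> t" "0 \<le> u" for s t u
    using that laplace[of "\<lambda>i. if i = 0 then 0 else if i = 1 then s else t" 2 "\<lambda>i. if i = 0 then 0 else u"]
    by (simp add: numeral_2_eq_2 \<Psi>0)
  have nonneg: "AE \<omega> in M. 0 \<le> S t \<omega> - S s \<omega>" if "0 \<le> s" "s \<le> t" for s t
    using paths that by (auto elim: eventually_mono)
  show "subordinator M S"
  proof
    show "random_variable borel (S t)" if "0 \<le> t" for t using meas that .
    show "AE \<omega> in M.
          S 0 \<omega> = 0 \<and>
          (\<forall>s t. 0 \<le> s \<and> s \<le> t \<longrightarrow> S s \<omega> \<le> S t \<omega>) \<and>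
          (\<forall>s\<ge>0. ((\<lambda>t. S t \<omega>) \<longlongrightarrow> S s \<omega>) (at_right s))" by fact
  next
    fix s t s' t' :: real
    assume *: "0 \<le> s" "s \<le> t" "0 \<le> s'" "s' \<le> t'" "t - s = t' - s'"
    then have [measurable]: "S s \<in> borel_measurable M" "S t \<in> borel_measurable M"
      "S s' \<in> borel_measurable M" "S t' \<in> borel_measurable M" by (auto intro: meas)
    show "distr M borel (\<lambda>\<omega>. S t \<omega> - S s \<omega>) = distr M borel (\<lambda>\<omega>. S t' \<omega> - S s' \<omega>)"
    proof (rule laplace_unique)
      show "AE x in distr M borel (\<lambda>\<omega>. S t \<omega> - S s \<omega>). 0 \<le> x"
        "AE x in distr M borel (\<lambda>\<omega>. S t' \<omega> - S s' \<omega>). 0 \<le> x"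
        using nonneg[of s t] nonneg[of s' t'] * by (simp_all add: AE_distr_iff)
      show "(LINT x|distr M borel (\<lambda>\<omega>. S t \<omega> - S s \<omega>). exp (- u * x)) =
         (LINT x|distr M borel (\<lambda>\<omega>. S t' \<omega> - S s' \<omega>). exp (- u * x))" if "0 \<le> u" for u
        using incr[of s t u] incr[of s' t' u] * that by (simp add: integral_distr)
    qed (auto intro!: finite_measure_distr)
  next
    fix n :: nat and \<tau> :: "nat \<Rightarrow> real"
    assume \<tau>: "\<tau> 0 = 0" "\<And>i. i < n \<Longrightarrow> \<tau> i \<le> \<tau> (Suc i)"
    have \<tau>0: "0 \<le> \<tau> i" if "i \<le> n" for i
      using that
    proof (induction i)
      case (Suc i)
      then show ?case using \<tau>(2)[of i] by simp
    qed (simp add: \<tau>)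
    show "indep_vars (\<lambda>_. borel) (\<lambda>i \<omega>. S (\<tau> (Suc i)) \<omega> - S (\<tau> i) \<omega>) {..<n}"
    proof (rule indep_vars_laplace)
      fix i assume "i \<in> {..<n}"
      then show "random_variable borel (\<lambda>\<omega>. S (\<tau> (Suc i)) \<omega> - S (\<tau> i) \<omega>)"
        "AE \<omega> in M. 0 \<le> S (\<tau> (Suc i)) \<omega> - S (\<tau> i) \<omega>"
        using \<tau>0[of i] \<tau>0[of "Suc i"] \<tau>(2)[of i] nonneg by (auto intro!: borel_measurable_diff meas)
    next
      fix u :: "nat \<Rightarrow> real" assume u: "\<And>i. i \<in> {..<n} \<Longrightarrow> 0 \<le> u i"
      show "(LINT \<omega>|M. (\<Prod>i<n. exp (- u i * (S (\<tau> (Suc i)) \<omega> - S (\<tau> i) \<omega>))))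
        = (\<Prod>i<n. LINT \<omega>|M. exp (- u i * (S (\<tau> (Suc i)) \<omega> - S (\<tau> i) \<omega>)))"
        using u \<tau>0 \<tau>(2) by (subst laplace[OF \<tau>]) (auto intro!: prod.cong incr[symmetric, simplified])
    qed simp
  qed
  have S0: "AE \<omega> in M. S 0 \<omega> = 0" using paths by (auto elim: eventually_mono)
  show "is_laplace_exponent M S \<Psi>"
    unfolding is_laplace_exponent_def
  proof (intro allI impI)
    fix t u :: real assume *: "0 \<le> t" "0 \<le> u"
    have "(LINT \<omega>|M. exp (- u * S t \<omega>)) = (LINT \<omega>|M. exp (- u * (S t \<omega> - S 0 \<omega>)))"
      using S0 meas * by (intro integral_cong_AE) (auto elim: eventually_mono)
    then show "(LINT \<omega>|M. exp (- u * S t \<omega>)) = exp (- t * \<Psi> u)"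
      using incr[of 0 t u] * by simp
  qed
qed

section \<open>Poisson point processes\<close>

text \<open>Projection to the coordinates in J turns the infinite product into a finite one, where
  Fubini applies; the bound 1 supplies integrability.\<close>

lemma (in product_prob_space) integral_PiM_prod:
  fixes f :: "'i \<Rightarrow> 'a \<Rightarrow> real"
  assumes J: "finite J" "J \<subseteq> I"
    and f: "\<And>i. i \<in> J \<Longrightarrow> f i \<in> borel_measurable (M i)" "\<And>i x. \<bar>f i x\<bar> \<le> 1"
  shows "(LINT \<omega>|PiM I M. (\<Prod>i\<in>J. f i (\<omega> i))) = (\<Prod>i\<in>J. LINT x|M i. f i x)"
proof -
  have int: "integrable (M i) (f i)" if "i \<in> J" for i
    using f that by (intro M.integrable_const_bound[where B=1]) auto
  have meas: "(\<lambda>\<omega>. \<Prod>i\<in>J. f i (\<omega> i)) \<in> borel_measurable (PiM J M)"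
    using f(1) by (intro borel_measurable_prod measurable_compose[OF measurable_component_singleton]) auto
  have "(LINT \<omega>|PiM I M. (\<Prod>i\<in>J. f i (\<omega> i))) = (LINT \<omega>|PiM I M. (\<Prod>i\<in>J. f i (restrict \<omega> J i)))"
    by (intro Bochner_Integration.integral_cong) auto
  also have "\<dots> = (LINT \<omega>|distr (PiM I M) (PiM J M) (\<lambda>\<omega>. restrict \<omega> J). (\<Prod>i\<in>J. f i (\<omega> i)))"
    using meas J by (subst integral_distr) (auto intro!: measurable_restrict_subset)
  also have "\<dots> = (LINT \<omega>|PiM J M. (\<Prod>i\<in>J. f i (\<omega> i)))"
    using distr_PiM_restrict_finite[OF J] by simp
  also have "\<dots> = (\<Prod>i\<in>J. LINT x|M i. f i x)"
    by (intro product_integral_prod J int)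
  finally show ?thesis .
qed

lemma measurable_prod_points [measurable]:
  fixes g :: "'p \<Rightarrow> real"
  assumes [measurable]: "g \<in> borel_measurable \<kappa>"
  shows "(\<lambda>\<omega>. \<Prod>k<fst \<omega>. g (snd \<omega> k)) \<in> borel_measurable (count_space UNIV \<Otimes>\<^sub>M (\<Pi>\<^sub>M k\<in>(UNIV::nat set). \<kappa>))"
    and "(\<lambda>\<omega>. \<Sum>k<fst \<omega>. g (snd \<omega> k)) \<in> borel_measurable (count_space UNIV \<Otimes>\<^sub>M (\<Pi>\<^sub>M k\<in>(UNIV::nat set). \<kappa>))"
  by (rule measurable_pair_measure_countable1; simp)+

text \<open>
  A configuration \<open>(n, y)\<close> encodes the finite multiset of points \<open>y 0, \<dots>, y (n - 1)\<close>; the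
  remaining entries of \<open>y\<close> carry no information.
\<close>

lemma finite_poisson_process:
  fixes \<kappa> :: "'p measure"
  assumes "finite_measure \<kappa>" and ne: "space \<kappa> \<noteq> {}"
  obtains C :: "(nat \<times> (nat \<Rightarrow> 'p)) measure" where
    "prob_space C" "sets C = sets (count_space UNIV \<Otimes>\<^sub>M (\<Pi>\<^sub>M k\<in>UNIV. \<kappa>))"
    "\<And>g :: 'p \<Rightarrow> real. g \<in> borel_measurable \<kappa> \<Longrightarrow> (\<And>x. 0 \<le> g x) \<Longrightarrow> (\<And>x. g x \<le> 1) \<Longrightarrow>
      (LINT \<omega>|C. (\<Prod>k<fst \<omega>. g (snd \<omega> k))) = exp (- (LINT x|\<kappa>. 1 - g x))"
proof -
  interpret finite_measure \<kappa> by fact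
  define m where "m = measure \<kappa> (space \<kappa>)"
  show ?thesis
  proof (cases "m = 0")
    \<comment> \<open>With zero intensity there is no law of a single point to normalise to. The
      process is the empty configuration, and \<open>x0\<close> merely fills its idle
      entries.\<close>
    case True
    then have "emeasure \<kappa> (space \<kappa>) = 0" by (simp add: m_def emeasure_eq_measure)
    then have zero: "AE x in \<kappa>. False" by (intro AE_I[of _ _ "space \<kappa>"]) auto
    obtain x0 where x0: "x0 \<in> space \<kappa>" using ne by auto
    let ?N = "count_space (UNIV :: nat set) \<Otimes>\<^sub>M (\<Pi>\<^sub>M k\<in>(UNIV::nat set). \<kappa>)"
    have sp: "(0::nat, \<lambda>_. x0) \<in> space ?N"
      using x0 by (auto simp: space_pair_measure space_PiM)
    show ?thesis
    proof (rule that[of "return ?N (0, \<lambda>_. x0)"])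
      show "prob_space (return ?N (0, \<lambda>_. x0))" using sp by (rule prob_space_return)
      fix g :: "'p \<Rightarrow> real" assume g[measurable]: "g \<in> borel_measurable \<kappa>"
      have "(LINT x|\<kappa>. 1 - g x) = (LINT x|\<kappa>. 0)"
        using zero by (intro integral_cong_AE) (auto elim: eventually_mono)
      then show "(LINT \<omega>|return ?N (0, \<lambda>_. x0). (\<Prod>k<fst \<omega>. g (snd \<omega> k))) = exp (- (LINT x|\<kappa>. 1 - g x))"
        using sp by (subst integral_return) auto
    qed simp
  next
    case False
    then have m: "0 < m" by (simp add: m_def less_le)
    \<comment> \<open>Normalised intensity, the law of one point. The number of points is Poisson
      with mean m, the total mass, and independent of the positions.\<close>
    define D where "D = density \<kappa> (\<lambda>_. ennreal (1 / m))"
    have sets_D [measurable_cong]: "sets D = sets \<kappa>" by (simp add: D_def)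
    interpret D: prob_space D
      by (rule prob_spaceI)
        (use m in \<open>simp add: D_def emeasure_density emeasure_eq_measure m_def[symmetric] ennreal_mult[symmetric] cong: nn_integral_cong\<close>)
    interpret P: product_prob_space "\<lambda>_. D" "UNIV :: nat set" ..
    let ?Q = "measure_pmf (poisson_pmf m)" and ?P = "\<Pi>\<^sub>M k\<in>(UNIV::nat set). D"
    interpret Q: prob_space ?Q by (rule prob_space_measure_pmf)
    show ?thesis
    proof (rule that[of "?Q \<Otimes>\<^sub>M ?P"])
      show "prob_space (?Q \<Otimes>\<^sub>M ?P)"
        by (intro prob_space_pair prob_space_PiM prob_space_measure_pmf D.prob_space_axioms)
      show sets: "sets (?Q \<Otimes>\<^sub>M ?P) = sets (count_space UNIV \<Otimes>\<^sub>M (\<Pi>\<^sub>M k\<in>UNIV. \<kappa>))"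
        by (intro sets_pair_measure_cong sets_PiM_cong) (auto simp: sets_D)
      fix g :: "'p \<Rightarrow> real"
      assume g[measurable]: "g \<in> borel_measurable \<kappa>" and g0: "\<And>x. 0 \<le> g x" and g1: "\<And>x. g x \<le> 1"
      define q where "q = (LINT x|D. g x)"
      have q0: "0 \<le> q" unfolding q_def using g0 by simp
      have g_int: "integrable \<kappa> g"
        using g0 g1 by (intro integrable_const_bound[where B=1]) auto
      have mq: "m * q = m - (LINT x|\<kappa>. 1 - g x)"
        using m g_int unfolding q_def D_def
        by (subst integral_density) (auto simp: m_def Bochner_Integration.integral_diff)
      have meas[measurable]: "(\<lambda>\<omega>. \<Prod>k<fst \<omega>. g (snd \<omega> k)) \<in> borel_measurable (?Q \<Otimes>\<^sub>M ?P)"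
        using measurable_prod_points(1)[OF g] measurable_cong_sets[OF sets refl] by blast
      have nn: "0 \<le> (\<Prod>k<n. g (y k))" for n y by (intro prod_nonneg) (use g0 in auto)
      have inner: "(\<integral>\<^sup>+y. ennreal (\<Prod>k<n. g (y k)) \<partial>?P) = ennreal (q ^ n)" for n :: nat
      proof -
        have "(LINT y|?P. (\<Prod>k<n. g (y k))) = q ^ n"
          using g0 g1 P.integral_PiM_prod[of "{..<n}" "\<lambda>_. g"] by (simp add: q_def)
        moreover have "integrable ?P (\<lambda>y. \<Prod>k<n. g (y k))"
        proof (rule P.integrable_const_bound[where B=1])
          show "AE y in ?P. norm (\<Prod>k<n. g (y k)) \<le> 1"
            using g0 g1 by (intro AE_I2) (simp add: abs_prod prod_le_1)
        qed measurable
        ultimately show ?thesis using nn by (subst nn_integral_eq_integral) auto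
      qed
      have "(\<integral>\<^sup>+\<omega>. ennreal (\<Prod>k<fst \<omega>. g (snd \<omega> k)) \<partial>(?Q \<Otimes>\<^sub>M ?P)) = (\<integral>\<^sup>+n. \<integral>\<^sup>+y. ennreal (\<Prod>k<n. g (y k)) \<partial>?P \<partial>?Q)"
        by (subst P.nn_integral_fst[symmetric]) auto
      also have "\<dots> = (\<integral>\<^sup>+n. ennreal (q ^ n) \<partial>?Q)" by (simp add: inner)
      \<comment> \<open>Given n points, the product has conditional mean \<open>q ^ n\<close>;
        summing against the Poisson weights gives the generating function
        \<open>exp (m * q - m)\<close>, and \<open>mq\<close> turns its exponent into the required
        integral.\<close>
      also have "\<dots> = (\<Sum>n. ennreal ((m * q) ^ n /\<^sub>R fact n * exp (- m)))"
        using m q0 by (simp add: nn_integral_measure_pmf nn_integral_count_space_nat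
            ennreal_mult'[symmetric] field_simps power_mult_distrib)
      also have "\<dots> = ennreal (exp (m * q) * exp (- m))"
        using m q0 by (intro suminf_ennreal_eq sums_mult2 exp_converges) auto
      also have "exp (m * q) * exp (- m) = exp (- (LINT x|\<kappa>. 1 - g x))"
        by (simp add: mq exp_diff exp_minus inverse_eq_divide)
      finally show "(LINT \<omega>|(?Q \<Otimes>\<^sub>M ?P). (\<Prod>k<fst \<omega>. g (snd \<omega> k))) = exp (- (LINT x|\<kappa>. 1 - g x))"
        using nn by (intro nn_integral_eq_integrable[THEN iffD1, THEN conjunct2]) auto
    qed
  qed
qed

section \<open>Sums over infinitely many points\<close>

text \<open>The function exp (- x) on [0, \<infinity>]. It remains multiplicative there, so
  divergent sums need no separate treatment in Laplace functionals.\<close>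

definition eneg :: "ennreal \<Rightarrow> real" where
  "eneg x = (if x = \<top> then 0 else exp (- enn2real x))"

lemma eneg_ennreal [simp]: "0 \<le> x \<Longrightarrow> eneg (ennreal x) = exp (- x)"
  by (simp add: eneg_def)

lemma eneg_0 [simp]: "eneg 0 = 1" by (simp add: eneg_def)
lemma eneg_top [simp]: "eneg \<top> = 0" by (simp add: eneg_def)
lemma eneg_bounds: "0 \<le> eneg x" "eneg x \<le> 1" by (simp_all add: eneg_def)

lemma measurable_eneg [measurable]: "eneg \<in> borel_measurable borel"
  unfolding eneg_def[abs_def] by measurable

lemma eneg_add: "eneg (x + y) = eneg x * eneg y"
proof (cases "x = \<top> \<or> y = \<top>")
  case False
  then show ?thesis by (cases x; cases y) (auto simp: exp_add[symmetric] simp flip: ennreal_plus)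
qed auto

lemma eneg_sum: "finite A \<Longrightarrow> eneg (\<Sum>i\<in>A. f i) = (\<Prod>i\<in>A. eneg (f i))"
  by (induction A rule: finite_induct) (auto simp: eneg_add)

text \<open>Divergence is covered as well: partial sums that grow to infinity drive the exponential
  to 0, the value of \<open>eneg\<close> at \<open>\<top>\<close>.\<close>

lemma tendsto_eneg_suminf:
  assumes a: "\<And>m. 0 \<le> a m"
  shows "(\<lambda>M. exp (- (\<Sum>m<M. a m))) \<longlonglongrightarrow> eneg (\<Sum>m. ennreal (a m))"
proof (cases "(\<Sum>m. ennreal (a m)) = \<top>")
  case True
  have "(\<lambda>M. \<Sum>m<M. ennreal (a m)) \<longlonglongrightarrow> (\<Sum>m. ennreal (a m))" by (rule summable_LIMSEQ) simp
  then have "(\<lambda>M. ennreal (\<Sum>m<M. a m)) \<longlonglongrightarrow> \<top>" using True a by simp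
  then have "LIM M sequentially. (\<Sum>m<M. a m) :> at_top" by (simp add: ennreal_tendsto_top_eq_at_top)
  then have "LIM M sequentially. - (\<Sum>m<M. a m) :> at_bot" by (simp add: filterlim_uminus_at_top)
  then have "(\<lambda>M. exp (- (\<Sum>m<M. a m))) \<longlonglongrightarrow> 0" by (rule filterlim_compose[OF exp_at_bot])
  then show ?thesis by (simp add: True)
next
  case False
  then have s: "summable a" using a by (simp add: summable_suminf_not_top)
  then have "(\<lambda>M. exp (- (\<Sum>m<M. a m))) \<longlonglongrightarrow> exp (- (\<Sum>m. a m))"
    by (intro tendsto_intros summable_LIMSEQ)
  then show ?thesis using a s by (simp add: suminf_ennreal2 suminf_nonneg)
qed

text \<open>A sequence of finite configurations stands for their superposition. The value lies in
  [0, \<infinity>] because infinitely many points may contribute; inner sums are meant to be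
  nonnegative, as \<open>ennreal\<close> cuts negative ones to 0.\<close>

definition point_sum :: "('p \<Rightarrow> real) \<Rightarrow> (nat \<Rightarrow> nat \<times> (nat \<Rightarrow> 'p)) \<Rightarrow> ennreal" where
  "point_sum f \<omega> = (\<Sum>m. ennreal (\<Sum>k<fst (\<omega> m). f (snd (\<omega> m) k)))"

lemma point_sum_add:
  assumes "\<And>p. 0 \<le> f p" "\<And>p. 0 \<le> g p"
  shows "point_sum (\<lambda>p. f p + g p) \<omega> = point_sum f \<omega> + point_sum g \<omega>"
  unfolding point_sum_def
  by (subst suminf_add) (auto simp: sum.distrib ennreal_plus sum_nonneg assms)

lemma point_sum_cmult:
  assumes "\<And>p. 0 \<le> f p" "0 \<le> c"
  shows "point_sum (\<lambda>p. c * f p) \<omega> = ennreal c * point_sum f \<omega>"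
  unfolding point_sum_def using assms
  by (simp add: sum_distrib_left[symmetric] ennreal_mult sum_nonneg flip: ennreal_suminf_cmult)

lemma point_sum_zero [simp]: "point_sum (\<lambda>_. 0) \<omega> = 0"
  by (simp add: point_sum_def)

lemma point_sum_sum:
  assumes "finite A" "\<And>i p. 0 \<le> f i p"
  shows "point_sum (\<lambda>p. \<Sum>i\<in>A. f i p) \<omega> = (\<Sum>i\<in>A. point_sum (f i) \<omega>)"
  using assms by (induction A rule: finite_induct) (auto simp: point_sum_add sum_nonneg)

lemma point_sum_mono:
  assumes "\<And>p. 0 \<le> f p" "\<And>p. f p \<le> g p"
  shows "point_sum f \<omega> \<le> point_sum g \<omega>"
  unfolding point_sum_def by (intro suminf_le ennreal_leI sum_mono assms) auto

text \<open>Independent finite processes live on the cells of a partition. Their Laplace functionals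
  multiply, so the exponents add, and the integrals over the cells sum to the integral over the
  whole space.\<close>

lemma poisson_process:
  fixes \<nu> :: "'p measure"
  assumes "sigma_finite_measure \<nu>" and ne: "space \<nu> \<noteq> {}"
  obtains \<Omega> :: "(nat \<Rightarrow> nat \<times> (nat \<Rightarrow> 'p)) measure" where
    "prob_space \<Omega>"
    "\<And>f. f \<in> borel_measurable \<nu> \<Longrightarrow> point_sum f \<in> borel_measurable \<Omega>"
    "\<And>f. f \<in> borel_measurable \<nu> \<Longrightarrow> (\<And>p. 0 \<le> f p) \<Longrightarrow>
      (LINT \<omega>|\<Omega>. eneg (point_sum f \<omega>)) = eneg (\<integral>\<^sup>+p. ennreal (1 - exp (- f p)) \<partial>\<nu>)"
proof -
  interpret sigma_finite_measure \<nu> by fact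
  obtain A :: "nat \<Rightarrow> 'p set" where A: "range A \<subseteq> sets \<nu>" "(\<Union>i. A i) = space \<nu>"
    "\<And>i. emeasure \<nu> (A i) \<noteq> \<infinity>" "disjoint_family A"
    using sigma_finite_disjoint by blast
  have [measurable]: "A i \<in> sets \<nu>" for i using A(1) by auto
  \<comment> \<open>The restriction of \<nu> to a cell, written as a density so that the space and
    the measurable sets remain those of \<nu>.\<close>
  define \<kappa> where "\<kappa> m = density \<nu> (indicator (A m))" for m
  have sets_\<kappa> [measurable_cong]: "sets (\<kappa> m) = sets \<nu>" for m by (simp add: \<kappa>_def)
  have fin: "finite_measure (\<kappa> m)" for m
  proof (rule finite_measureI)
    have "emeasure (\<kappa> m) (space (\<kappa> m)) = (\<integral>\<^sup>+p. indicator (A m) p \<partial>\<nu>)"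
      unfolding \<kappa>_def by (subst emeasure_density) (auto intro!: nn_integral_cong)
    then show "emeasure (\<kappa> m) (space (\<kappa> m)) \<noteq> \<infinity>" using A(3)[of m] by simp
  qed
  let ?N = "count_space (UNIV :: nat set) \<Otimes>\<^sub>M (\<Pi>\<^sub>M k\<in>(UNIV::nat set). \<nu>)"
  have exC: "\<exists>C. prob_space C \<and> sets C = sets (count_space UNIV \<Otimes>\<^sub>M (\<Pi>\<^sub>M k\<in>(UNIV::nat set). \<kappa> m)) \<and>
    (\<forall>g :: 'p \<Rightarrow> real. g \<in> borel_measurable (\<kappa> m) \<longrightarrow> (\<forall>x. 0 \<le> g x) \<longrightarrow> (\<forall>x. g x \<le> 1) \<longrightarrow>
      (LINT \<omega>|C. (\<Prod>k<fst \<omega>. g (snd \<omega> k))) = exp (- (LINT x|\<kappa> m. 1 - g x)))" for m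
  proof (rule finite_poisson_process[OF fin[of m]])
    show "space (\<kappa> m) \<noteq> {}" using ne by (simp add: \<kappa>_def)
    fix C :: "(nat \<times> (nat \<Rightarrow> 'p)) measure"
    assume C: "prob_space C" "sets C = sets (count_space UNIV \<Otimes>\<^sub>M (\<Pi>\<^sub>M k\<in>UNIV. \<kappa> m))"
      "\<And>g :: 'p \<Rightarrow> real. g \<in> borel_measurable (\<kappa> m) \<Longrightarrow> (\<And>x. 0 \<le> g x) \<Longrightarrow> (\<And>x. g x \<le> 1) \<Longrightarrow>
        (LINT \<omega>|C. (\<Prod>k<fst \<omega>. g (snd \<omega> k))) = exp (- (LINT x|\<kappa> m. 1 - g x))"
    show ?thesis by (intro exI[of _ C] conjI allI impI C) auto
  qed
  obtain C where C_all: "\<forall>m. prob_space (C m) \<and> sets (C m) = sets (count_space UNIV \<Otimes>\<^sub>M (\<Pi>\<^sub>M k\<in>(UNIV::nat set). \<kappa> m)) \<and>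
    (\<forall>g :: 'p \<Rightarrow> real. g \<in> borel_measurable (\<kappa> m) \<longrightarrow> (\<forall>x. 0 \<le> g x) \<longrightarrow> (\<forall>x. g x \<le> 1) \<longrightarrow>
      (LINT \<omega>|C m. (\<Prod>k<fst \<omega>. g (snd \<omega> k))) = exp (- (LINT x|\<kappa> m. 1 - g x)))"
    by (rule exE[OF choice[OF allI[OF exC]]])
  have C: "prob_space (C m)"
    "sets (C m) = sets (count_space UNIV \<Otimes>\<^sub>M (\<Pi>\<^sub>M k\<in>(UNIV::nat set). \<kappa> m))" for m
    using C_all by auto
  have C_int: "(LINT \<omega>|C m. (\<Prod>k<fst \<omega>. g (snd \<omega> k))) = exp (- (LINT x|\<kappa> m. 1 - g x))"
    if "g \<in> borel_measurable (\<kappa> m)" "\<And>x. 0 \<le> g x" "\<And>x. g x \<le> 1" for m and g :: "'p \<Rightarrow> real"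
    using C_all that by blast
  have sets_C [measurable_cong]: "sets (C m) = sets ?N" for m
    unfolding C(2) by (intro sets_pair_measure_cong sets_PiM_cong) (auto simp: sets_\<kappa>)
  interpret C: prob_space "C m" for m by (rule C)
  interpret P: product_prob_space C "UNIV :: nat set" ..
  have comp: "(\<lambda>\<omega>. \<Sum>k<fst (\<omega> m). f (snd (\<omega> m) k)) \<in> borel_measurable (PiM UNIV C)"
    if "f \<in> borel_measurable \<nu>" for f :: "'p \<Rightarrow> real" and m
    using measurable_prod_points(2)[OF that] measurable_cong_sets[OF sets_C refl]
    by (intro measurable_compose[OF measurable_component_singleton[of m UNIV C]]) auto
  have meas: "point_sum f \<in> borel_measurable (PiM UNIV C)" if [measurable]: "f \<in> borel_measurable \<nu>" for f
    unfolding point_sum_def[abs_def] using comp[OF that] by measurable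
  show ?thesis
  proof (rule that[of "PiM UNIV C"])
    show "prob_space (PiM UNIV C)" by (intro prob_space_PiM C)
    show "point_sum f \<in> borel_measurable (PiM UNIV C)" if "f \<in> borel_measurable \<nu>" for f
      using meas that .
    fix f :: "'p \<Rightarrow> real"
    assume f[measurable]: "f \<in> borel_measurable \<nu>" and f0: "\<And>p. 0 \<le> f p"
    define g where "g p = exp (- f p)" for p
    have [measurable]: "g \<in> borel_measurable \<nu>" unfolding g_def by measurable
    have g: "0 \<le> g p" "g p \<le> 1" for p using f0 by (auto simp: g_def)
    define a where "a m = (LINT p|\<kappa> m. 1 - g p)" for m
    have a0: "0 \<le> a m" for m unfolding a_def using g by (intro integral_nonneg_AE) auto
    define s where "s \<omega> m = (\<Sum>k<fst (\<omega> m). f (snd (\<omega> m) k))" for \<omega> :: "nat \<Rightarrow> nat \<times> (nat \<Rightarrow> 'p)" and m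
    have s0: "0 \<le> s \<omega> m" for \<omega> m unfolding s_def by (intro sum_nonneg f0)
    have [measurable]: "(\<lambda>\<omega>. s \<omega> m) \<in> borel_measurable (PiM UNIV C)" for m
      unfolding s_def by (rule comp) fact
    have "(LINT \<omega>|PiM UNIV C. exp (- (\<Sum>m<M. s \<omega> m))) = exp (- (\<Sum>m<M. a m))" for M
    proof -
      have "(LINT \<omega>|PiM UNIV C. exp (- (\<Sum>m<M. s \<omega> m)))
        = (LINT \<omega>|PiM UNIV C. (\<Prod>m<M. (\<Prod>k<fst (\<omega> m). g (snd (\<omega> m) k))))"
        by (simp add: s_def g_def exp_sum sum_negf[symmetric])
      also have "\<dots> = (\<Prod>m<M. LINT \<omega>|C m. (\<Prod>k<fst \<omega>. g (snd \<omega> k)))"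
      proof (intro P.integral_PiM_prod)
        show "(\<lambda>\<omega>. \<Prod>k<fst \<omega>. g (snd \<omega> k)) \<in> borel_measurable (C m)" for m by measurable
        show "\<bar>\<Prod>k<fst \<omega>. g (snd \<omega> k)\<bar> \<le> 1" for \<omega> :: "nat \<times> (nat \<Rightarrow> 'p)"
          using g by (simp add: abs_prod prod_le_1)
      qed auto
      also have "\<dots> = (\<Prod>m<M. exp (- a m))"
        unfolding a_def using g by (intro prod.cong C_int) auto
      finally show ?thesis by (simp add: exp_sum sum_negf[symmetric])
    qed
    \<comment> \<open>Nonnegative sums keep the exponentials below 1, so dominated convergence
      passes from finitely many cells to all of them.\<close>
    moreover have "(\<lambda>M. LINT \<omega>|PiM UNIV C. exp (- (\<Sum>m<M. s \<omega> m))) \<longlonglongrightarrow> (LINT \<omega>|PiM UNIV C. eneg (point_sum f \<omega>))"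
    proof (rule integral_dominated_convergence[where w="\<lambda>_. 1"])
      show "AE \<omega> in PiM UNIV C. (\<lambda>M. exp (- (\<Sum>m<M. s \<omega> m))) \<longlonglongrightarrow> eneg (point_sum f \<omega>)"
        unfolding point_sum_def s_def[symmetric] by (intro AE_I2 tendsto_eneg_suminf s0)
      show "AE \<omega> in PiM UNIV C. norm (exp (- (\<Sum>m<M. s \<omega> m))) \<le> 1" for M
        using s0 by (auto intro!: sum_nonneg)
      show "(\<lambda>\<omega>. eneg (point_sum f \<omega>)) \<in> borel_measurable (PiM UNIV C)"
        using meas[OF f] by measurable
    qed auto
    moreover have "(\<lambda>M. exp (- (\<Sum>m<M. a m))) \<longlonglongrightarrow> eneg (\<Sum>m. ennreal (a m))"
      by (rule tendsto_eneg_suminf) (rule a0)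
    ultimately have "(LINT \<omega>|PiM UNIV C. eneg (point_sum f \<omega>)) = eneg (\<Sum>m. ennreal (a m))"
      using LIMSEQ_unique by auto
    also have "(\<Sum>m. ennreal (a m)) = (\<Sum>m. \<integral>\<^sup>+p. ennreal (1 - g p) \<partial>\<kappa> m)"
    proof (intro suminf_cong)
      fix m
      interpret finite_measure "\<kappa> m" by (rule fin)
      have "integrable (\<kappa> m) (\<lambda>p. 1 - g p)"
        using g by (intro integrable_const_bound[where B=1]) auto
      then show "ennreal (a m) = (\<integral>\<^sup>+p. ennreal (1 - g p) \<partial>\<kappa> m)"
        unfolding a_def using g by (intro nn_integral_eq_integral[symmetric]) auto
    qed
    also have "\<dots> = (\<Sum>m. \<integral>\<^sup>+p. indicator (A m) p * ennreal (1 - g p) \<partial>\<nu>)"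
      unfolding \<kappa>_def by (intro suminf_cong nn_integral_density) auto
    also have "\<dots> = (\<integral>\<^sup>+p. (\<Sum>m. indicator (A m) p * ennreal (1 - g p)) \<partial>\<nu>)"
      by (intro nn_integral_suminf[symmetric]) auto
    also have "\<dots> = (\<integral>\<^sup>+p. ennreal (1 - g p) \<partial>\<nu>)"
      by (intro nn_integral_cong) (simp add: suminf_indicator[OF A(4)] A(2))
    finally show "(LINT \<omega>|PiM UNIV C. eneg (point_sum f \<omega>)) = eneg (\<integral>\<^sup>+p. ennreal (1 - exp (- f p)) \<partial>\<nu>)"
      by (simp add: g_def)
  qed
qed

section \<open>Construction of the subordinator\<close>

text \<open>By Markov's inequality the sets where \<open>min x 1\<close> is at least 1/n have finite
  measure; they exhaust the half-line because \<open>min x 1\<close> is strictly positive on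
  it.\<close>

lemma levy_measure_sigma_finite:
  assumes L: "levy_measure \<Lambda>"
  shows "sigma_finite_measure \<Lambda>"
proof
  note [measurable] = halfline_measure_measurable[OF levy_measureD(1)[OF L]]
  define A where "A n = {x \<in> space \<Lambda>. 1 \<le> ennreal (real n) * ennreal (min x 1)}" for n :: nat
  have "A n \<in> sets \<Lambda>" for n unfolding A_def by measurable
  moreover have "emeasure \<Lambda> (A n) \<noteq> \<infinity>" for n
  proof -
    have "emeasure \<Lambda> (A n) \<le> ennreal (real n) * (\<integral>\<^sup>+x. ennreal (min x 1) * indicator (space \<Lambda>) x \<partial>\<Lambda>)"
      unfolding A_def by (rule nn_integral_Markov_inequality) auto
    also have "(\<integral>\<^sup>+x. ennreal (min x 1) * indicator (space \<Lambda>) x \<partial>\<Lambda>) = (\<integral>\<^sup>+x. ennreal (min x 1) \<partial>\<Lambda>)"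
      by (intro nn_integral_cong) auto
    also have "\<dots> = ennreal (LINT x|\<Lambda>. min x 1)"
    proof (rule nn_integral_eq_integral[OF levy_measureD(2)[OF L]])
      show "AE x in \<Lambda>. 0 \<le> min x 1"
        using halfline_measure_space[OF levy_measureD(1)[OF L]] by (intro AE_I2) simp
    qed
    also have "ennreal (real n) * \<dots> < \<top>" by (simp add: ennreal_mult_less_top)
    finally show ?thesis by simp
  qed
  moreover have "(\<Union>n. A n) = space \<Lambda>"
  proof safe
    fix x assume x: "x \<in> space \<Lambda>"
    then have "0 < min x 1" using halfline_measure_space[OF levy_measureD(1)[OF L]] by simp
    then obtain n :: nat where "1 < real n * min x 1"
      using ex_less_of_nat_mult[of "min x 1" 1] by auto
    then have "x \<in> A n" using x \<open>0 < min x 1\<close>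
      by (simp add: A_def ennreal_mult'[symmetric] del: ennreal_1 flip: ennreal_1)
    then show "x \<in> (\<Union>n. A n)" by auto
  qed (auto simp: A_def)
  ultimately show "\<exists>A. countable A \<and> A \<subseteq> sets \<Lambda> \<and> \<Union> A = space \<Lambda> \<and> (\<forall>a\<in>A. emeasure \<Lambda> a \<noteq> \<infinity>)"
    by (intro exI[of _ "range A"]) auto
qed

text \<open>The pair p is (time, size). The absolute value changes nothing on the half-line that
  carries \<Lambda> and gives nonnegativity for every p, as the lemmas on \<open>point_sum\<close>
  require. Intervals closed on the right make the increments additive and the paths
  right-continuous.\<close>

definition jumps :: "real \<Rightarrow> real \<Rightarrow> real \<times> real \<Rightarrow> real" where
  "jumps s t p = indicator {s<..t} (fst p) * \<bar>snd p\<bar>"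

lemma jumps_nonneg [simp]: "0 \<le> jumps s t p" by (simp add: jumps_def)

lemma jumps_add: "r \<le> s \<Longrightarrow> s \<le> t \<Longrightarrow> jumps r t p = jumps r s p + jumps s t p"
  by (auto simp: jumps_def indicator_def)

lemma jumps_mono: "t \<le> t' \<Longrightarrow> jumps s t p \<le> jumps s t' p"
  by (auto simp: jumps_def indicator_def)

lemma steps_mono:
  fixes \<tau> :: "nat \<Rightarrow> real"
  assumes "\<And>i. i < n \<Longrightarrow> \<tau> i \<le> \<tau> (Suc i)" "i \<le> j" "j \<le> n"
  shows "\<tau> i \<le> \<tau> j"
  using assms(2,3)
proof (induction j rule: dec_induct)
  case (step j)
  then show ?case using assms(1)[of j] by simp
qed simp

text \<open>The intervals are disjoint, so a point meets at most one of them and at most one term of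
  the exponent is nonzero; hence the nonlinear expression splits into a sum.\<close>

lemma one_minus_exp_jumps:
  fixes \<tau> u :: "nat \<Rightarrow> real"
  assumes "\<And>i. i < n \<Longrightarrow> \<tau> i \<le> \<tau> (Suc i)"
  shows "1 - exp (- (\<Sum>i<n. u i * jumps (\<tau> i) (\<tau> (Suc i)) p))
    = (\<Sum>i<n. indicator {\<tau> i<..\<tau> (Suc i)} (fst p) * (1 - exp (- u i * \<bar>snd p\<bar>)))"
  using assms
proof (induction n)
  case (Suc n)
  show ?case
  proof (cases "fst p \<in> {\<tau> n<..\<tau> (Suc n)}")
    case True
    have "fst p \<notin> {\<tau> i<..\<tau> (Suc i)}" if "i < n" for i
      using steps_mono[of n \<tau> "Suc i" n] Suc.prems that True by force
    then show ?thesis using True by (simp add: jumps_def)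
  next
    case False
    then show ?thesis using Suc by (simp add: jumps_def)
  qed
qed simp

text \<open>Of the Poisson process with intensity Lebesgue measure times \<Lambda>, only the
  measurability of point sums and the Laplace functional are retained; finiteness of the sums and
  the law of the increments are derived from the latter.\<close>

locale levy_poisson = prob_space \<Omega>
  for \<Omega> :: "(nat \<Rightarrow> nat \<times> (nat \<Rightarrow> real \<times> real)) measure" +
  fixes \<beta> :: real and \<Lambda> :: "real measure"
  assumes \<beta>: "0 \<le> \<beta>" and levy: "levy_measure \<Lambda>"
    and measurable_point_sum: "\<And>f. f \<in> borel_measurable (lborel \<Otimes>\<^sub>M \<Lambda>) \<Longrightarrow> point_sum f \<in> borel_measurable \<Omega>"
    and laplace_point_sum: "\<And>f. f \<in> borel_measurable (lborel \<Otimes>\<^sub>M \<Lambda>) \<Longrightarrow> (\<And>p. 0 \<le> f p) \<Longrightarrow>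
      (LINT \<omega>|\<Omega>. eneg (point_sum f \<omega>)) = eneg (\<integral>\<^sup>+p. ennreal (1 - exp (- f p)) \<partial>(lborel \<Otimes>\<^sub>M \<Lambda>))"
begin

lemma measurable_jumps [measurable]: "jumps s t \<in> borel_measurable (lborel \<Otimes>\<^sub>M \<Lambda>)"
proof -
  have [measurable]: "(\<lambda>x. \<bar>x\<bar>) \<in> borel_measurable \<Lambda>"
    by (rule halfline_measure_measurable[OF levy_measureD(1)[OF levy]]) measurable
  show ?thesis unfolding jumps_def[abs_def] by measurable
qed

definition \<psi> :: "real \<Rightarrow> real" where "\<psi> u = (LINT x|\<Lambda>. 1 - exp (- u * x))"

lemma \<psi>_nonneg: "0 \<le> u \<Longrightarrow> 0 \<le> \<psi> u"
  unfolding \<psi>_def using halfline_measure_space[OF levy_measureD(1)[OF levy]]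
  by (intro integral_nonneg_AE AE_I2) auto

lemma nn_integral_\<psi>: "0 \<le> u \<Longrightarrow> (\<integral>\<^sup>+x. ennreal (1 - exp (- u * \<bar>x\<bar>)) \<partial>\<Lambda>) = ennreal (\<psi> u)"
proof -
  assume u: "0 \<le> u"
  have "(\<integral>\<^sup>+x. ennreal (1 - exp (- u * \<bar>x\<bar>)) \<partial>\<Lambda>) = (\<integral>\<^sup>+x. ennreal (1 - exp (- u * x)) \<partial>\<Lambda>)"
    using halfline_measure_space[OF levy_measureD(1)[OF levy]] by (intro nn_integral_cong) auto
  also have "\<dots> = ennreal (\<psi> u)"
    unfolding \<psi>_def
  proof (rule nn_integral_eq_integral[OF levy_measureD(3)[OF levy u]])
    show "AE x in \<Lambda>. 0 \<le> 1 - exp (- u * x)"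
      using u halfline_measure_space[OF levy_measureD(1)[OF levy]] by (intro AE_I2) simp
  qed
  finally show ?thesis .
qed

text \<open>By \<open>one_minus_exp_jumps\<close> the intensity integral splits into strips; by
  Tonelli each strip contributes its length times the jump exponent \<open>\<psi>\<close>.\<close>

lemma laplace_jumps:
  fixes \<tau> u :: "nat \<Rightarrow> real"
  assumes \<tau>: "\<And>i. i < n \<Longrightarrow> \<tau> i \<le> \<tau> (Suc i)" and u: "\<And>i. i < n \<Longrightarrow> 0 \<le> u i"
  shows "(LINT \<omega>|\<Omega>. eneg (\<Sum>i<n. ennreal (u i) * point_sum (jumps (\<tau> i) (\<tau> (Suc i))) \<omega>))
    = exp (- (\<Sum>i<n. (\<tau> (Suc i) - \<tau> i) * \<psi> (u i)))"
proof -
  interpret L: sigma_finite_measure \<Lambda> by (rule levy_measure_sigma_finite[OF levy])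
  \<comment> \<open>Agrees with u below n and is nonnegative at every index, as
    \<open>point_sum_sum\<close> demands.\<close>
  define v where "v i = max 0 (u i)" for i
  define f where "f p = (\<Sum>i<n. v i * jumps (\<tau> i) (\<tau> (Suc i)) p)" for p
  have [measurable]: "f \<in> borel_measurable (lborel \<Otimes>\<^sub>M \<Lambda>)" unfolding f_def[abs_def] by measurable
  have nn: "0 \<le> (\<tau> (Suc i) - \<tau> i) * \<psi> (u i)" if "i < n" for i
    using \<tau>[OF that] \<psi>_nonneg[OF u[OF that]] by simp
  have f0: "0 \<le> f p" for p unfolding f_def v_def by (intro sum_nonneg mult_nonneg_nonneg) auto
  have "(\<Sum>i<n. ennreal (u i) * point_sum (jumps (\<tau> i) (\<tau> (Suc i))) \<omega>) = point_sum f \<omega>" for \<omega>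
    unfolding f_def using u
    by (subst point_sum_sum) (auto simp: v_def point_sum_cmult max_def intro!: sum.cong)
  moreover have "(LINT \<omega>|\<Omega>. eneg (point_sum f \<omega>)) = eneg (\<integral>\<^sup>+p. ennreal (1 - exp (- f p)) \<partial>(lborel \<Otimes>\<^sub>M \<Lambda>))"
    by (rule laplace_point_sum) (auto simp: f0)
  moreover have "(\<integral>\<^sup>+p. ennreal (1 - exp (- f p)) \<partial>(lborel \<Otimes>\<^sub>M \<Lambda>)) = ennreal (\<Sum>i<n. (\<tau> (Suc i) - \<tau> i) * \<psi> (u i))"
  proof -
    define h where "h i x = ennreal (1 - exp (- v i * \<bar>x\<bar>))" for i and x :: real
    have h[measurable]: "h i \<in> borel_measurable \<Lambda>" for i
      unfolding h_def[abs_def] by (rule halfline_measure_measurable[OF levy_measureD(1)[OF levy]]) measurable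
    have pt: "ennreal (1 - exp (- f p)) = (\<Sum>i<n. indicator {\<tau> i<..\<tau> (Suc i)} (fst p) * h i (snd p))" for p
    proof -
      have nn: "0 \<le> 1 - exp (- v i * \<bar>x\<bar>)" for i x by (simp add: v_def)
      have "1 - exp (- f p) = (\<Sum>i<n. indicator {\<tau> i<..\<tau> (Suc i)} (fst p) * (1 - exp (- v i * \<bar>snd p\<bar>)))"
        unfolding f_def by (rule one_minus_exp_jumps[of n \<tau> v p, OF \<tau>])
      also have "ennreal \<dots> = (\<Sum>i<n. ennreal (indicator {\<tau> i<..\<tau> (Suc i)} (fst p) * (1 - exp (- v i * \<bar>snd p\<bar>))))"
        by (intro sum_ennreal[symmetric] mult_nonneg_nonneg nn) simp
      also have "\<dots> = (\<Sum>i<n. indicator {\<tau> i<..\<tau> (Suc i)} (fst p) * h i (snd p))"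
        unfolding h_def by (intro sum.cong refl) (simp add: indicator_def)
      finally show ?thesis .
    qed
    have hI: "(\<lambda>p. indicator {\<tau> i<..\<tau> (Suc i)} (fst p) * h i (snd p)) \<in> borel_measurable (lborel \<Otimes>\<^sub>M \<Lambda>)" for i
      by measurable
    have "(\<integral>\<^sup>+p. ennreal (1 - exp (- f p)) \<partial>(lborel \<Otimes>\<^sub>M \<Lambda>))
      = (\<Sum>i<n. \<integral>\<^sup>+p. indicator {\<tau> i<..\<tau> (Suc i)} (fst p) * h i (snd p) \<partial>(lborel \<Otimes>\<^sub>M \<Lambda>))"
      unfolding pt by (intro nn_integral_sum hI)
    also have "\<dots> = (\<Sum>i<n. ennreal ((\<tau> (Suc i) - \<tau> i) * \<psi> (u i)))"
    proof (intro sum.cong refl)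
      fix i assume "i \<in> {..<n}"
      then have i: "i < n" by simp
      have int_h: "(\<integral>\<^sup>+x. h i x \<partial>\<Lambda>) = ennreal (\<psi> (u i))"
        using u[OF i] nn_integral_\<psi>[of "u i"] by (simp add: h_def v_def max_def)
      have "(\<integral>\<^sup>+p. indicator {\<tau> i<..\<tau> (Suc i)} (fst p) * h i (snd p) \<partial>(lborel \<Otimes>\<^sub>M \<Lambda>))
        = (\<integral>\<^sup>+t. \<integral>\<^sup>+x. indicator {\<tau> i<..\<tau> (Suc i)} t * h i x \<partial>\<Lambda> \<partial>lborel)"
        using L.nn_integral_fst[OF hI] by simp
      also have "\<dots> = (\<integral>\<^sup>+t. indicator {\<tau> i<..\<tau> (Suc i)} t * ennreal (\<psi> (u i)) \<partial>lborel)"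
        by (intro nn_integral_cong) (simp add: nn_integral_cmult int_h)
      also have "\<dots> = ennreal (\<tau> (Suc i) - \<tau> i) * ennreal (\<psi> (u i))"
        using \<tau>[OF i] by (simp add: nn_integral_multc)
      also have "\<dots> = ennreal ((\<tau> (Suc i) - \<tau> i) * \<psi> (u i))"
        using \<psi>_nonneg[OF u[OF i]] \<tau>[OF i] by (simp add: ennreal_mult)
      finally show "(\<integral>\<^sup>+p. indicator {\<tau> i<..\<tau> (Suc i)} (fst p) * h i (snd p) \<partial>(lborel \<Otimes>\<^sub>M \<Lambda>))
        = ennreal ((\<tau> (Suc i) - \<tau> i) * \<psi> (u i))" .
    qed
    also have "\<dots> = ennreal (\<Sum>i<n. (\<tau> (Suc i) - \<tau> i) * \<psi> (u i))"
      by (intro sum_ennreal nn) simp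
    finally show ?thesis .
  qed
  moreover have "0 \<le> (\<Sum>i<n. (\<tau> (Suc i) - \<tau> i) * \<psi> (u i))"
    by (intro sum_nonneg nn) simp
  ultimately show ?thesis by simp
qed

text \<open>As c decreases to 0, \<open>eneg (c * x)\<close> tends to 1 for finite x and to 0 for
  infinite x, so the Laplace transform tends to the probability of finiteness; its explicit value
  \<open>exp (- (t * \<psi> c))\<close> tends to 1.\<close>

lemma AE_finite_jumps:
  assumes "0 \<le> t"
  shows "AE \<omega> in \<Omega>. point_sum (jumps 0 t) \<omega> < \<top>"
proof -
  have [measurable]: "point_sum (jumps 0 t) \<in> borel_measurable \<Omega>"
    by (rule measurable_point_sum) measurable
  let ?J = "point_sum (jumps 0 t)"
  let ?A = "{\<omega> \<in> space \<Omega>. ?J \<omega> < \<top>}"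
  let ?c = "\<lambda>k. inverse (real (Suc k))"
  have "(LINT \<omega>|\<Omega>. eneg (ennreal (?c k) * ?J \<omega>)) = exp (- (t * \<psi> (?c k)))" for k
    using laplace_jumps[of 1 "\<lambda>i. if i = 0 then 0 else t" "\<lambda>_. ?c k"] assms by simp
  moreover have "(\<lambda>k. LINT \<omega>|\<Omega>. eneg (ennreal (?c k) * ?J \<omega>)) \<longlonglongrightarrow> (LINT \<omega>|\<Omega>. indicator ?A \<omega>)"
  proof (rule integral_dominated_convergence[where w="\<lambda>_. 1"])
    show "AE \<omega> in \<Omega>. (\<lambda>k. eneg (ennreal (?c k) * ?J \<omega>)) \<longlonglongrightarrow> indicator ?A \<omega>"
    proof (rule AE_I2)
      fix \<omega> assume \<omega>: "\<omega> \<in> space \<Omega>"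
      show "(\<lambda>k. eneg (ennreal (?c k) * ?J \<omega>)) \<longlonglongrightarrow> indicator ?A \<omega>"
      proof (cases "?J \<omega>")
        case (real r)
        then have "(\<lambda>k. eneg (ennreal (?c k) * ?J \<omega>)) = (\<lambda>k. exp (- (?c k * r)))"
          by (simp add: ennreal_mult[symmetric] del: of_nat_Suc)
        moreover have "(\<lambda>k. exp (- (?c k * r))) \<longlonglongrightarrow> exp (- (0 * r))"
          by (intro tendsto_intros LIMSEQ_inverse_real_of_nat)
        ultimately show ?thesis using real \<omega> by (simp add: less_top[symmetric])
      next
        case top
        then show ?thesis by (simp add: ennreal_mult_top del: of_nat_Suc)
      qed
    qed
  qed (auto simp: eneg_bounds)
  \<comment> \<open>Since \<open>?c k \<le> 1\<close>, the integrand at u = 1 dominates.\<close>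
  moreover have "(\<lambda>k. \<psi> (?c k)) \<longlonglongrightarrow> (LINT x|\<Lambda>. 0)"
    unfolding \<psi>_def
  proof (rule integral_dominated_convergence[where w="\<lambda>x. 1 - exp (- 1 * x)"])
    show "AE x in \<Lambda>. (\<lambda>k. 1 - exp (- ?c k * x)) \<longlonglongrightarrow> 0"
    proof (rule AE_I2)
      fix x :: real
      have "(\<lambda>k. 1 - exp (- ?c k * x)) \<longlonglongrightarrow> 1 - exp (- 0 * x)"
        by (intro tendsto_intros LIMSEQ_inverse_real_of_nat)
      then show "(\<lambda>k. 1 - exp (- ?c k * x)) \<longlonglongrightarrow> 0" by simp
    qed
    show "AE x in \<Lambda>. norm (1 - exp (- ?c k * x)) \<le> 1 - exp (- 1 * x)" for k
    proof (rule AE_I2)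
      fix x assume "x \<in> space \<Lambda>"
      then have x: "0 < x" using halfline_measure_space[OF levy_measureD(1)[OF levy]] by simp
      then have "?c k * x \<le> 1 * x" by (intro mult_right_mono) (auto simp: field_simps)
      then show "norm (1 - exp (- ?c k * x)) \<le> 1 - exp (- 1 * x)" using x by simp
    qed
    show "integrable \<Lambda> (\<lambda>x. 1 - exp (- 1 * x))" by (rule levy_measureD(3)[OF levy]) simp
    show "(\<lambda>x. 1 - exp (- ?c k * x)) \<in> borel_measurable \<Lambda>" for k
      by (rule halfline_measure_measurable[OF levy_measureD(1)[OF levy]]) measurable
  qed simp
  then have "(\<lambda>k. exp (- (t * \<psi> (?c k)))) \<longlonglongrightarrow> exp (- (t * 0))"
    by (intro tendsto_intros) simp
  ultimately have "(LINT \<omega>|\<Omega>. indicator ?A \<omega>) = (1::real)"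
    using LIMSEQ_unique by fastforce
  then have "prob ?A = 1" by (simp add: Int_absorb2)
  then have "AE \<omega> in \<Omega>. \<omega> \<in> ?A" by (rule AE_prob_1)
  then show ?thesis by (auto elim: eventually_mono)
qed

text \<open>\<open>enn2real\<close> gives the value 0 to an infinite sum; by
  \<open>AE_finite_jumps_all\<close> this concerns only a null set, off which S t is the drift plus
  the sum of the jumps up to time t.\<close>

definition S :: "real \<Rightarrow> (nat \<Rightarrow> nat \<times> (nat \<Rightarrow> real \<times> real)) \<Rightarrow> real" where
  "S t \<omega> = \<beta> * t + enn2real (point_sum (jumps 0 t) \<omega>)"

text \<open>Every t lies below an integer and the sums are monotone in t, so one null set serves all
  times at once.\<close>

lemma AE_finite_jumps_all:
  "AE \<omega> in \<Omega>. \<forall>t. point_sum (jumps 0 t) \<omega> < \<top>"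
proof -
  have "AE \<omega> in \<Omega>. \<forall>n::nat. point_sum (jumps 0 (real n)) \<omega> < \<top>"
    by (simp add: AE_all_countable AE_finite_jumps)
  then show ?thesis
  proof (rule eventually_mono, intro allI)
    fix \<omega> and t :: real assume *: "\<forall>n::nat. point_sum (jumps 0 (real n)) \<omega> < \<top>"
    obtain n :: nat where "t \<le> real n" using real_arch_simple by blast
    then have "point_sum (jumps 0 t) \<omega> \<le> point_sum (jumps 0 (real n)) \<omega>"
      by (intro point_sum_mono jumps_mono) auto
    with * show "point_sum (jumps 0 t) \<omega> < \<top>" using le_less_trans by blast
  qed
qed

lemma S_increment:
  assumes "point_sum (jumps 0 t) \<omega> < \<top>" "0 \<le> s" "s \<le> t"
  shows "point_sum (jumps s t) \<omega> = ennreal (S t \<omega> - S s \<omega> - \<beta> * (t - s))"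
    and "\<beta> * (t - s) \<le> S t \<omega> - S s \<omega>"
proof -
  have "jumps 0 t = (\<lambda>p. jumps 0 s p + jumps s t p)"
    by (intro ext jumps_add assms)
  then have *: "point_sum (jumps 0 t) \<omega> = point_sum (jumps 0 s) \<omega> + point_sum (jumps s t) \<omega>"
    by (simp add: point_sum_add)
  with assms(1) have "point_sum (jumps 0 s) \<omega> < \<top>" "point_sum (jumps s t) \<omega> < \<top>" by auto
  with * show "point_sum (jumps s t) \<omega> = ennreal (S t \<omega> - S s \<omega> - \<beta> * (t - s))"
    "\<beta> * (t - s) \<le> S t \<omega> - S s \<omega>"
    by (auto simp: S_def enn2real_plus algebra_simps)
qed

text \<open>Just to the right of s the contribution of each single point is constant, since
  \<open>{0<..t}\<close> is closed at t. The values at s + 1 dominate the series over the cells, so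
  Tannery's theorem exchanges limit and sum.\<close>

lemma S_right_continuous:
  assumes fin: "\<And>t. point_sum (jumps 0 t) \<omega> < \<top>"
  shows "((\<lambda>t. S t \<omega>) \<longlongrightarrow> S s \<omega>) (at_right s)"
proof -
  define b where "b m t = (\<Sum>k<fst (\<omega> m). jumps 0 t (snd (\<omega> m) k))" for m t
  have b0: "0 \<le> b m t" for m t unfolding b_def by (intro sum_nonneg) auto
  have b_mono: "b m t \<le> b m t'" if "t \<le> t'" for m t t'
    unfolding b_def by (intro sum_mono jumps_mono that)
  have summ: "summable (\<lambda>m. b m t)" for t
    using fin[of t] b0 unfolding point_sum_def b_def[symmetric] by (simp add: summable_suminf_not_top)
  have eq: "enn2real (point_sum (jumps 0 t) \<omega>) = (\<Sum>m. b m t)" for t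
    unfolding point_sum_def b_def[symmetric]
    by (subst suminf_ennreal2) (auto simp: b0 summ suminf_nonneg)
  have ind: "((\<lambda>t. jumps 0 t p) \<longlongrightarrow> jumps 0 s p) (at_right s)" for p
  proof -
    have "eventually (\<lambda>t. jumps 0 t p = jumps 0 s p) (at_right s)"
    proof (cases "fst p \<le> s")
      case True
      then show ?thesis
        by (intro eventually_mono[OF eventually_at_right_less[of s]]) (auto simp: jumps_def indicator_def)
    next
      case False
      then show ?thesis
        by (intro eventually_mono[OF eventually_at_right_real[of s "fst p"]]) (auto simp: jumps_def indicator_def)
    qed
    then show ?thesis by (rule tendsto_eventually)
  qed
  have "eventually (\<lambda>t. t \<in> {s<..<s+1}) (at_right s)" by (rule eventually_at_right_real) simp
  then have "eventually (\<lambda>t. \<forall>m. norm (b m t) \<le> b m (s + 1)) (at_right s)"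
    by (rule eventually_mono) (auto simp: b0 b_mono)
  then have "eventually (\<lambda>(m, t). norm (b m t) \<le> b m (s + 1)) (at_top \<times>\<^sub>F at_right s)"
    unfolding eventually_prod_filter
    by (intro exI[of _ "\<lambda>_. True"] exI[of _ "\<lambda>t. \<forall>m. norm (b m t) \<le> b m (s + 1)"]) auto
  moreover have "((\<lambda>t. b m t) \<longlongrightarrow> b m s) (at_right s)" for m
    unfolding b_def by (intro tendsto_sum ind)
  ultimately have "((\<lambda>t. \<Sum>m. b m t) \<longlongrightarrow> (\<Sum>m. b m s)) (at_right s)"
    using tannerys_theorem[of b "\<lambda>m. b m s" "at_right s" "\<lambda>m. b m (s + 1)"] summ by auto
  then have "((\<lambda>t. \<beta> * t + (\<Sum>m. b m t)) \<longlongrightarrow> \<beta> * s + (\<Sum>m. b m s)) (at_right s)"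
    by (intro tendsto_intros)
  then show ?thesis by (simp add: S_def eq)
qed

lemma measurable_S [measurable]: "S t \<in> borel_measurable \<Omega>"
proof -
  have [measurable]: "point_sum (jumps 0 t) \<in> borel_measurable \<Omega>"
    by (rule measurable_point_sum) measurable
  show ?thesis unfolding S_def[abs_def] by measurable
qed

lemma S_paths:
  "AE \<omega> in \<Omega>. S 0 \<omega> = 0 \<and> (\<forall>s t. 0 \<le> s \<and> s \<le> t \<longrightarrow> S s \<omega> \<le> S t \<omega>) \<and>
     (\<forall>s\<ge>0. ((\<lambda>t. S t \<omega>) \<longlongrightarrow> S s \<omega>) (at_right s))"
  using AE_finite_jumps_all
proof eventually_elim
  case (elim \<omega>)
  have "jumps 0 0 = (\<lambda>_. 0)" by (auto simp: jumps_def)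
  then have "S 0 \<omega> = 0" by (simp add: S_def)
  moreover have "S s \<omega> \<le> S t \<omega>" if "0 \<le> s" "s \<le> t" for s t
  proof -
    have "0 \<le> \<beta> * (t - s)" using \<beta> that by simp
    then show ?thesis using S_increment(2)[OF elim[rule_format, of t] that] by linarith
  qed
  ultimately show ?case using S_right_continuous elim by blast
qed

lemma laplace_S_increments:
  fixes \<tau> u :: "nat \<Rightarrow> real"
  assumes \<tau>: "\<tau> 0 = 0" "\<And>i. i < n \<Longrightarrow> \<tau> i \<le> \<tau> (Suc i)" and u: "\<And>i. i < n \<Longrightarrow> 0 \<le> u i"
  shows "(LINT \<omega>|\<Omega>. (\<Prod>i<n. exp (- u i * (S (\<tau> (Suc i)) \<omega> - S (\<tau> i) \<omega>))))
    = (\<Prod>i<n. exp (- (\<tau> (Suc i) - \<tau> i) * levy_khintchine \<beta> \<Lambda> (u i)))"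
proof -
  let ?E = "\<lambda>\<omega>. eneg (\<Sum>i<n. ennreal (u i) * point_sum (jumps (\<tau> i) (\<tau> (Suc i))) \<omega>)"
  \<comment> \<open>The contribution of the drift is deterministic, hence a constant factor of the
    integral.\<close>
  let ?c = "\<Prod>i<n. exp (- (u i * \<beta> * (\<tau> (Suc i) - \<tau> i)))"
  have \<tau>0: "0 \<le> \<tau> i" if "i \<le> n" for i
    using steps_mono[of n \<tau> 0 i] \<tau> that by simp
  have [measurable]: "point_sum (jumps s t) \<in> borel_measurable \<Omega>" for s t
    by (rule measurable_point_sum) measurable
  have "(LINT \<omega>|\<Omega>. (\<Prod>i<n. exp (- u i * (S (\<tau> (Suc i)) \<omega> - S (\<tau> i) \<omega>)))) = (LINT \<omega>|\<Omega>. ?c * ?E \<omega>)"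
  proof (rule integral_cong_AE)
    show "AE \<omega> in \<Omega>. (\<Prod>i<n. exp (- u i * (S (\<tau> (Suc i)) \<omega> - S (\<tau> i) \<omega>))) = ?c * ?E \<omega>"
      using AE_finite_jumps_all
    proof eventually_elim
      case (elim \<omega>)
      have "?E \<omega> = (\<Prod>i<n. eneg (ennreal (u i) * point_sum (jumps (\<tau> i) (\<tau> (Suc i))) \<omega>))"
        by (rule eneg_sum) simp
      also have "\<dots> = (\<Prod>i<n. exp (- (u i * (S (\<tau> (Suc i)) \<omega> - S (\<tau> i) \<omega> - \<beta> * (\<tau> (Suc i) - \<tau> i)))))"
      proof (intro prod.cong refl)
        fix i assume "i \<in> {..<n}"
        then have i: "i < n" by simp
        note inc = S_increment[OF elim[rule_format, of "\<tau> (Suc i)"] \<tau>0[of i] \<tau>(2)[OF i]]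
        have "0 \<le> u i * (S (\<tau> (Suc i)) \<omega> - S (\<tau> i) \<omega> - \<beta> * (\<tau> (Suc i) - \<tau> i))"
          using inc(2) u[OF i] i by simp
        then show "eneg (ennreal (u i) * point_sum (jumps (\<tau> i) (\<tau> (Suc i))) \<omega>)
          = exp (- (u i * (S (\<tau> (Suc i)) \<omega> - S (\<tau> i) \<omega> - \<beta> * (\<tau> (Suc i) - \<tau> i))))"
          using inc i u[OF i] by (simp add: ennreal_mult[symmetric])
      qed
      finally show ?case
        by (simp add: prod.distrib[symmetric] exp_add[symmetric] algebra_simps)
    qed
  qed measurable
  also have "\<dots> = ?c * exp (- (\<Sum>i<n. (\<tau> (Suc i) - \<tau> i) * \<psi> (u i)))"
    using laplace_jumps[of n \<tau> u, OF \<tau>(2) u] by simp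
  also have "\<dots> = (\<Prod>i<n. exp (- (\<tau> (Suc i) - \<tau> i) * levy_khintchine \<beta> \<Lambda> (u i)))"
    by (simp add: exp_sum sum_negf[symmetric] prod.distrib[symmetric] exp_add[symmetric]
        levy_khintchine_def \<psi>_def algebra_simps)
  finally show ?thesis .
qed

end

lemma levy_poisson_exists:
  assumes "0 \<le> \<beta>" "levy_measure \<Lambda>"
  obtains \<Omega> where "levy_poisson \<Omega> \<beta> \<Lambda>"
proof -
  have sf: "sigma_finite_measure (lborel \<Otimes>\<^sub>M \<Lambda>)"
    by (intro sigma_finite_pair_measure levy_measure_sigma_finite assms sigma_finite_lborel)
  have "(0, 1) \<in> space (lborel \<Otimes>\<^sub>M \<Lambda>)"
    using halfline_measure_space[OF levy_measureD(1)[OF assms(2)]] by (simp add: space_pair_measure)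
  then have ne: "space (lborel \<Otimes>\<^sub>M \<Lambda>) \<noteq> {}" by blast
  show ?thesis
  proof (rule poisson_process[OF sf ne])
    fix \<Omega> :: "(nat \<Rightarrow> nat \<times> (nat \<Rightarrow> real \<times> real)) measure"
    assume *: "prob_space \<Omega>"
      "\<And>f. f \<in> borel_measurable (lborel \<Otimes>\<^sub>M \<Lambda>) \<Longrightarrow> point_sum f \<in> borel_measurable \<Omega>"
      "\<And>f. f \<in> borel_measurable (lborel \<Otimes>\<^sub>M \<Lambda>) \<Longrightarrow> (\<And>p. 0 \<le> f p) \<Longrightarrow>
        (LINT \<omega>|\<Omega>. eneg (point_sum f \<omega>)) = eneg (\<integral>\<^sup>+p. ennreal (1 - exp (- f p)) \<partial>(lborel \<Otimes>\<^sub>M \<Lambda>))"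
    have "levy_poisson \<Omega> \<beta> \<Lambda>"
    proof (intro levy_poisson.intro levy_poisson_axioms.intro assms *(1))
      show "point_sum f \<in> borel_measurable \<Omega>" if "f \<in> borel_measurable (lborel \<Otimes>\<^sub>M \<Lambda>)" for f
        using *(2) that .
      show "(LINT \<omega>|\<Omega>. eneg (point_sum f \<omega>)) = eneg (\<integral>\<^sup>+p. ennreal (1 - exp (- f p)) \<partial>(lborel \<Otimes>\<^sub>M \<Lambda>))"
        if "f \<in> borel_measurable (lborel \<Otimes>\<^sub>M \<Lambda>)" "\<And>p. 0 \<le> f p" for f
        using *(3) that by blast
    qed
    then show ?thesis by (rule that)
  qed
qed

section \<open>Change of the underlying probability space\<close>

text \<open>A sequence of configurations consists of countably many real numbers, so a real function
  can store it at the codes of triples (m, k, c): cell m, point k, and c selecting the number of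
  points, the time or the size. This moves the construction to the type
  \<open>real \<Rightarrow> real\<close> that \<open>subordinator_exists\<close> promises.\<close>

lemma embed_configurations:
  "\<exists>\<phi> :: (nat \<Rightarrow> nat \<times> (nat \<Rightarrow> real \<times> real)) \<Rightarrow> real \<Rightarrow> real. inj \<phi>"
proof -
  define \<phi> :: "(nat \<Rightarrow> nat \<times> (nat \<Rightarrow> real \<times> real)) \<Rightarrow> real \<Rightarrow> real" where
    "\<phi> \<omega> x = (case (from_nat (nat \<lfloor>x\<rfloor>) :: nat \<times> nat \<times> nat) of (m, k, c) \<Rightarrow>
      if c = 0 then real (fst (\<omega> m)) else if c = 1 then fst (snd (\<omega> m) k) else snd (snd (\<omega> m) k))" for \<omega> x
  have "\<omega> = \<omega>'" if "\<phi> \<omega> = \<phi> \<omega>'" for \<omega> \<omega>'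
  proof
    fix m :: nat
    have eq: "\<phi> \<omega> (real (to_nat (m, k, c))) = \<phi> \<omega>' (real (to_nat (m, k, c)))" for k c :: nat
      using that by simp
    have "fst (\<omega> m) = fst (\<omega>' m)" using eq[of 0 0] by (simp add: \<phi>_def)
    moreover have "snd (\<omega> m) k = snd (\<omega>' m) k" for k
      using eq[of k 1] eq[of k 2] by (simp add: \<phi>_def prod_eq_iff)
    ultimately show "\<omega> m = \<omega>' m" by (auto simp: prod_eq_iff)
  qed
  then show ?thesis by (auto simp: inj_def)
qed

lemma subordinator_exists:
  assumes "0 \<le> \<beta>" "levy_measure \<Lambda>"
  obtains M :: "(real \<Rightarrow> real) measure" and S where
    "subordinator M S" "is_laplace_exponent M S (levy_khintchine \<beta> \<Lambda>)"
proof -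
  obtain \<Omega> where "levy_poisson \<Omega> \<beta> \<Lambda>" using levy_poisson_exists[OF assms] .
  then interpret levy_poisson \<Omega> \<beta> \<Lambda> .
  obtain \<phi> :: "(nat \<Rightarrow> nat \<times> (nat \<Rightarrow> real \<times> real)) \<Rightarrow> real \<Rightarrow> real" where \<phi>: "inj \<phi>"
    using embed_configurations by blast
  have inv: "the_inv \<phi> (\<phi> \<omega>) = \<omega>" for \<omega> using \<phi> by (rule the_inv_f_f)
  \<comment> \<open>An injective embedding only renames the outcomes, so paths and expectations are
    those of S on \<Omega>.\<close>
  let ?M = "embed_measure \<Omega> \<phi>"
  define T where "T t x = S t (the_inv \<phi> x)" for t x
  have [measurable]: "T t \<in> borel_measurable ?M" for t
    by (rule measurable_embed_measure1) (simp add: T_def inv)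
  have "prob_space ?M"
    by (subst embed_measure_eq_distr[OF \<phi>]) (intro prob_space_distr measurable_embed_measure2 \<phi>)
  moreover have "AE x in ?M. T 0 x = 0 \<and> (\<forall>s t. 0 \<le> s \<and> s \<le> t \<longrightarrow> T s x \<le> T t x) \<and>
     (\<forall>s\<ge>0. ((\<lambda>t. T t x) \<longlongrightarrow> T s x) (at_right s))"
    using S_paths by (simp add: AE_embed_measure[OF \<phi>] T_def inv)
  moreover have "(LINT x|?M. (\<Prod>i<n. exp (- u i * (T (\<tau> (Suc i)) x - T (\<tau> i) x))))
    = (\<Prod>i<n. exp (- (\<tau> (Suc i) - \<tau> i) * levy_khintchine \<beta> \<Lambda> (u i)))"
    if "\<tau> 0 = 0" "\<And>i. i < n \<Longrightarrow> \<tau> i \<le> \<tau> (Suc i)" "\<And>i. i < n \<Longrightarrow> 0 \<le> u i" for n :: nat and \<tau> u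
  proof -
    have meas: "(\<lambda>x. \<Prod>i<n. exp (- u i * (T (\<tau> (Suc i)) x - T (\<tau> i) x))) \<in> borel_measurable ?M"
      by measurable
    have "(LINT x|?M. (\<Prod>i<n. exp (- u i * (T (\<tau> (Suc i)) x - T (\<tau> i) x))))
      = (LINT \<omega>|\<Omega>. (\<Prod>i<n. exp (- u i * (S (\<tau> (Suc i)) \<omega> - S (\<tau> i) \<omega>))))"
      by (subst embed_measure_eq_distr[OF \<phi>], subst integral_distr[OF measurable_embed_measure2[OF \<phi>] meas])
        (simp add: T_def inv)
    then show ?thesis using laplace_S_increments[OF that] by simp
  qed
  ultimately show ?thesis
    by (intro that[of ?M T] subordinatorI_laplace) auto
qed

section \<open>Uniqueness of drift and Levy measure\<close>

lemma levy_khintchine_diff: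
  assumes L: "levy_measure \<Lambda>" and u: "0 \<le> u"
  shows "levy_khintchine \<beta> \<Lambda> (u + 1) - levy_khintchine \<beta> \<Lambda> u = \<beta> + (LINT x|\<Lambda>. (1 - exp (- x)) * exp (- u * x))"
proof -
  have eq: "(1 - exp (- (u + 1) * x)) - (1 - exp (- u * x)) = (1 - exp (- x)) * exp (- u * x)" for x :: real
    by (simp add: algebra_simps exp_add[symmetric])
  have int: "integrable \<Lambda> (\<lambda>x. 1 - exp (- (u + 1) * x))" "integrable \<Lambda> (\<lambda>x. 1 - exp (- u * x))"
    using levy_measureD(3)[OF L, of "u + 1"] levy_measureD(3)[OF L, of u] u by simp_all
  show "levy_khintchine \<beta> \<Lambda> (u + 1) - levy_khintchine \<beta> \<Lambda> u = \<beta> + (LINT x|\<Lambda>. (1 - exp (- x)) * exp (- u * x))"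
    using Bochner_Integration.integral_diff[OF int]
    by (simp only: eq levy_khintchine_def) (simp add: algebra_simps)
qed

text \<open>The space of \<Lambda> excludes 0, so \<open>exp (- n * x)\<close> tends to 0 at each of
  its points and the jump part of the unit difference disappears in the limit, dominated by
  \<open>1 - exp (- x)\<close>.\<close>

lemma levy_khintchine_drift_limit:
  assumes L: "levy_measure \<Lambda>"
  shows "(\<lambda>n. levy_khintchine \<beta> \<Lambda> (real n + 1) - levy_khintchine \<beta> \<Lambda> (real n)) \<longlonglongrightarrow> \<beta>"
proof -
  note [measurable] = halfline_measure_measurable[OF levy_measureD(1)[OF L]]
  have "(\<lambda>n. LINT x|\<Lambda>. (1 - exp (- x)) * exp (- real n * x)) \<longlonglongrightarrow> (LINT x|\<Lambda>. 0)"
  proof (rule integral_dominated_convergence[where w="\<lambda>x. 1 - exp (- 1 * x)"])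
    show "integrable \<Lambda> (\<lambda>x. 1 - exp (- 1 * x))" by (rule levy_measureD(3)[OF L]) simp
    show "AE x in \<Lambda>. (\<lambda>n. (1 - exp (- x)) * exp (- real n * x)) \<longlonglongrightarrow> 0"
    proof (rule AE_I2)
      fix x assume "x \<in> space \<Lambda>"
      then have "0 < x" using halfline_measure_space[OF levy_measureD(1)[OF L]] by simp
      then have "(\<lambda>n. exp (- x) ^ n) \<longlonglongrightarrow> 0" by (intro LIMSEQ_power_zero) simp
      then have "(\<lambda>n. (1 - exp (- x)) * exp (- x) ^ n) \<longlonglongrightarrow> (1 - exp (- x)) * 0"
        by (rule tendsto_mult[OF tendsto_const])
      moreover have "exp (- real n * x) = exp (- x) ^ n" for n
        by (simp add: exp_of_nat_mult[symmetric])
      ultimately show "(\<lambda>n. (1 - exp (- x)) * exp (- real n * x)) \<longlonglongrightarrow> 0"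
        by (simp only: mult_zero_right)
    qed
    show "AE x in \<Lambda>. norm ((1 - exp (- x)) * exp (- real n * x)) \<le> 1 - exp (- 1 * x)" for n
    proof (rule AE_I2)
      fix x assume "x \<in> space \<Lambda>"
      then have x: "0 < x" using halfline_measure_space[OF levy_measureD(1)[OF L]] by simp
      then have "(1 - exp (- x)) * exp (- real n * x) \<le> (1 - exp (- x)) * 1"
        by (intro mult_left_mono) auto
      then show "norm ((1 - exp (- x)) * exp (- real n * x)) \<le> 1 - exp (- 1 * x)"
        using x by simp
    qed
    show "(\<lambda>x. (1 - exp (- x)) * exp (- real n * x)) \<in> borel_measurable \<Lambda>" for n
      by (rule halfline_measure_measurable[OF levy_measureD(1)[OF L]]) measurable
  qed simp
  then have "(\<lambda>n. \<beta> + (LINT x|\<Lambda>. (1 - exp (- x)) * exp (- real n * x))) \<longlonglongrightarrow> \<beta> + 0"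
    by (intro tendsto_intros) simp
  then show ?thesis by (simp add: levy_khintchine_diff[OF L])
qed

text \<open>On the half-line \<open>1 - exp (- x)\<close> is strictly positive, so the weighted
  measure determines \<Lambda> by division. The push-forward along the identity to
  \<open>borel\<close> places the weighted measures on the whole line, where
  \<open>laplace_unique\<close> applies.\<close>

lemma levy_measure_eqI:
  assumes L: "levy_measure \<Lambda>" and L': "levy_measure \<Lambda>'"
    and eq: "distr (density \<Lambda> (\<lambda>x. ennreal (1 - exp (- x)))) borel (\<lambda>x. x)
      = distr (density \<Lambda>' (\<lambda>x. ennreal (1 - exp (- x)))) borel (\<lambda>x. x)"
  shows "\<Lambda> = \<Lambda>'"
proof (rule measure_eqI)
  have sets: "sets K = sets (restrict_space borel {0<..})" if "levy_measure K" for K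
    using levy_measureD(1)[OF that] by (simp add: halfline_measure_def)
  show "sets \<Lambda> = sets \<Lambda>'" using sets[OF L] sets[OF L'] by simp
  fix A assume "A \<in> sets \<Lambda>"
  then have A: "A \<in> sets borel" "A \<subseteq> {0<..}"
    by (auto simp: sets[OF L] sets_restrict_space_iff)
  define k where "k x = ennreal (1 / (1 - exp (- x))) * indicator A x" for x :: real
  have k[measurable]: "k \<in> borel_measurable borel" unfolding k_def[abs_def] using A by measurable
  have "emeasure K A = (\<integral>\<^sup>+x. k x \<partial>distr (density K (\<lambda>x. ennreal (1 - exp (- x)))) borel (\<lambda>x. x))"
    if K: "levy_measure K" for K
  proof -
    note m = halfline_measure_measurable[OF levy_measureD(1)[OF K]]
    have [measurable]: "(\<lambda>x. x) \<in> borel_measurable K" "k \<in> borel_measurable K"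
      "(\<lambda>x. 1 - exp (- x) :: real) \<in> borel_measurable K"
      by (rule m, measurable)+
    have "A \<in> sets K" using A by (auto simp: sets[OF K] sets_restrict_space_iff)
    then have "emeasure K A = (\<integral>\<^sup>+x. indicator A x \<partial>K)" by simp
    also have "\<dots> = (\<integral>\<^sup>+x. ennreal (1 - exp (- x)) * k x \<partial>K)"
    proof (rule nn_integral_cong)
      fix x assume "x \<in> space K"
      then have "0 < 1 - exp (- x)" using halfline_measure_space[OF levy_measureD(1)[OF K]] by simp
      then show "indicator A x = ennreal (1 - exp (- x)) * k x"
        by (simp add: k_def mult.assoc[symmetric] ennreal_mult[symmetric])
    qed
    also have "\<dots> = (\<integral>\<^sup>+x. k x \<partial>distr (density K (\<lambda>x. ennreal (1 - exp (- x)))) borel (\<lambda>x. x))"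
      by (subst nn_integral_distr) (auto simp: nn_integral_density)
    finally show ?thesis .
  qed
  from this[OF L] this[OF L'] eq show "emeasure \<Lambda> A = emeasure \<Lambda>' A" by simp
qed

text \<open>The drift is identified first, as the limit of the unit differences; subtracting it
  leaves the Laplace transforms of the two measures weighted by
  \<open>1 - exp (- x)\<close>.\<close>

lemma levy_khintchine_unique:
  assumes L: "levy_measure \<Lambda>" and L': "levy_measure \<Lambda>'"
    and eq: "\<And>u. 0 \<le> u \<Longrightarrow> levy_khintchine \<beta> \<Lambda> u = levy_khintchine \<beta>' \<Lambda>' u"
  shows "\<beta> = \<beta>'" "\<Lambda> = \<Lambda>'"
proof -
  show \<beta>: "\<beta> = \<beta>'"
    using levy_khintchine_drift_limit[OF L, of \<beta>] levy_khintchine_drift_limit[OF L', of \<beta>'] eq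
    by (auto intro: LIMSEQ_unique)
  let ?D = "\<lambda>K. distr (density K (\<lambda>x. ennreal (1 - exp (- x)))) borel (\<lambda>x. x)"
  have meas: "f \<in> borel_measurable borel \<Longrightarrow> f \<in> borel_measurable K" if "levy_measure K" for f :: "real \<Rightarrow> real" and K
    using halfline_measure_measurable[OF levy_measureD(1)[OF that]] .
  have AE_pos: "AE x in K. 0 < x" if "levy_measure K" for K
    using halfline_measure_space[OF levy_measureD(1)[OF that]] by (intro AE_I2) simp
  have lap: "(LINT x|?D K. exp (- u * x)) = (LINT x|K. (1 - exp (- x)) * exp (- u * x))"
    if K: "levy_measure K" for K u
  proof -
    have [measurable]: "(\<lambda>x. x) \<in> borel_measurable K" "(\<lambda>x. exp (- u * x)) \<in> borel_measurable K"
      "(\<lambda>x. 1 - exp (- x) :: real) \<in> borel_measurable K"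
      by (rule meas[OF K], measurable)+
    have "(LINT x|?D K. exp (- u * x)) = (LINT x|density K (\<lambda>x. ennreal (1 - exp (- x))). exp (- u * x))"
      by (rule integral_distr) measurable
    also have "\<dots> = (LINT x|K. (1 - exp (- x)) *\<^sub>R exp (- u * x))"
      using AE_pos[OF K] by (intro integral_density) (auto elim!: eventually_mono)
    finally show ?thesis by simp
  qed
  have fin: "finite_measure (?D K)" if K: "levy_measure K" for K
  proof -
    have [measurable]: "(\<lambda>x. x) \<in> borel_measurable K" "(\<lambda>x. 1 - exp (- x) :: real) \<in> borel_measurable K"
      by (rule meas[OF K], measurable)+
    have "emeasure (density K (\<lambda>x. ennreal (1 - exp (- x)))) (space K) = (\<integral>\<^sup>+x. ennreal (1 - exp (- x)) \<partial>K)"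
      by (subst emeasure_density) (auto intro!: nn_integral_cong)
    also have "\<dots> = ennreal (LINT x|K. 1 - exp (- x))"
      using levy_measureD(3)[OF K, of 1] AE_pos[OF K]
      by (intro nn_integral_eq_integral) (auto elim!: eventually_mono)
    finally have "finite_measure (density K (\<lambda>x. ennreal (1 - exp (- x))))"
      by (intro finite_measureI) simp
    then show ?thesis by (rule finite_measure.finite_measure_distr) simp
  qed
  have nonneg: "AE x in ?D K. 0 \<le> x" if K: "levy_measure K" for K
  proof -
    have [measurable]: "(\<lambda>x. x) \<in> borel_measurable K" "(\<lambda>x. 1 - exp (- x) :: real) \<in> borel_measurable K"
      by (rule meas[OF K], measurable)+
    show ?thesis
      using AE_pos[OF K] by (subst AE_distr_iff) (auto simp: AE_density elim!: eventually_mono)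
  qed
  have "?D \<Lambda> = ?D \<Lambda>'"
  proof (rule laplace_unique)
    fix u :: real assume u: "0 \<le> u"
    then show "(LINT x|?D \<Lambda>. exp (- u * x)) = (LINT x|?D \<Lambda>'. exp (- u * x))"
      using levy_khintchine_diff[OF L u, of \<beta>] levy_khintchine_diff[OF L' u, of \<beta>']
        eq[of u] eq[of "u + 1"] \<beta> unfolding lap[OF L] lap[OF L'] by linarith
  qed (auto simp: fin nonneg L L')
  then show "\<Lambda> = \<Lambda>'" by (rule levy_measure_eqI[OF L L'])
qed

section \<open>Cauchy's functional equation\<close>

text \<open>Nonnegativity makes an additive g monotone, and monotonicity takes the place of
  continuity in ruling out pathological solutions.\<close>

lemma additive_nonneg_linear:
  fixes g :: "real \<Rightarrow> real"
  assumes add: "\<And>s t. 0 \<le> s \<Longrightarrow> 0 \<le> t \<Longrightarrow> g (s + t) = g s + g t"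
    and nonneg: "\<And>t. 0 \<le> t \<Longrightarrow> 0 \<le> g t" and t: "0 \<le> t"
  shows "g t = t * g 1"
proof -
  have g0: "g 0 = 0" using add[of 0 0] by simp
  have mult: "g (real n * s) = real n * g s" if "0 \<le> s" for n s
    using that by (induction n) (auto simp: g0 add distrib_right)
  have mono: "g a \<le> g b" if "0 \<le> a" "a \<le> b" for a b
    using add[of a "b - a"] nonneg[of "b - a"] that by simp
  have g1: "0 \<le> g 1" by (rule nonneg) simp
  \<comment> \<open>Sandwiching \<open>n * t\<close> between the consecutive integers k and k + 1
    bounds the error by \<open>g 1\<close> for all n simultaneously, which forces the difference to
    be 0.\<close>
  have bound: "real n * \<bar>g t - t * g 1\<bar> \<le> g 1" for n :: nat
  proof -
    define k where "k = nat \<lfloor>real n * t\<rfloor>"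
    have k: "real k \<le> real n * t" "real n * t \<le> real (Suc k)"
      using t unfolding k_def by (auto simp: of_nat_nat floor_le_iff) linarith
    have "real k * g 1 \<le> real n * g t" "real n * g t \<le> real (Suc k) * g 1"
      using mono[OF _ k(1)] mono[OF _ k(2)] t mult[of t n] mult[of 1 k] mult[of 1 "Suc k"] by auto
    moreover have "real k * g 1 \<le> real n * t * g 1" "real n * t * g 1 \<le> real (Suc k) * g 1"
      using k g1 by (auto intro!: mult_right_mono simp del: of_nat_Suc)
    ultimately have "\<bar>real n * g t - real n * t * g 1\<bar> \<le> g 1" by (simp add: algebra_simps abs_le_iff)
    moreover have "real n * \<bar>g t - t * g 1\<bar> = \<bar>real n * g t - real n * t * g 1\<bar>"
      by (simp add: abs_mult[of "real n", simplified, symmetric] algebra_simps)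
    ultimately show ?thesis by simp
  qed
  show ?thesis
  proof (rule ccontr)
    assume "g t \<noteq> t * g 1"
    then have "0 < \<bar>g t - t * g 1\<bar>" by simp
    then obtain n :: nat where "g 1 < real n * \<bar>g t - t * g 1\<bar>"
      using ex_less_of_nat_mult by blast
    with bound[of n] show False by simp
  qed
qed

section \<open>The Laplace exponent of a subordinator\<close>

context subordinator
begin

definition laplace :: "real \<Rightarrow> real \<Rightarrow> real" where
  "laplace t u = (LINT \<omega>|M. exp (- u * S t \<omega>))"

lemma AE_nonneg: "0 \<le> t \<Longrightarrow> AE \<omega> in M. 0 \<le> S t \<omega>"
  using paths by (rule eventually_mono) (metis order_refl)

lemma AE_zero: "AE \<omega> in M. S 0 \<omega> = 0"
  using paths by (rule eventually_mono) simp

lemma integrable_laplace: "0 \<le> t \<Longrightarrow> 0 \<le> u \<Longrightarrow> integrable M (\<lambda>\<omega>. exp (- u * S t \<omega>))"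
proof -
  assume *: "0 \<le> t" "0 \<le> u"
  note [measurable] = measurable_process[OF *(1)]
  show ?thesis
    using AE_nonneg[OF *(1)] *(2) by (intro integrable_const_bound[where B=1]) (auto elim!: eventually_mono)
qed

lemma laplace_le_1: "0 \<le> t \<Longrightarrow> 0 \<le> u \<Longrightarrow> laplace t u \<le> 1"
proof -
  assume *: "0 \<le> t" "0 \<le> u"
  have "laplace t u \<le> (LINT \<omega>|M. 1)"
    unfolding laplace_def using AE_nonneg[OF *(1)] *
    by (intro integral_mono_AE integrable_laplace) (auto elim!: eventually_mono)
  then show ?thesis by (simp add: prob_space)
qed

lemma laplace_pos:
  assumes "0 \<le> t" "0 \<le> u"
  shows "0 < laplace t u"
proof -
  have "laplace t u \<noteq> 0"
  proof
    assume "laplace t u = 0"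
    then have "AE \<omega> in M. exp (- u * S t \<omega>) = 0"
      unfolding laplace_def
      by (subst (asm) integral_nonneg_eq_0_iff_AE[OF integrable_laplace[OF assms]]) auto
    then show False by simp
  qed
  moreover have "0 \<le> laplace t u" unfolding laplace_def by simp
  ultimately show ?thesis by simp
qed

lemma laplace_increment:
  assumes "0 \<le> s" "0 \<le> t"
  shows "(LINT \<omega>|M. exp (- u * (S (s + t) \<omega> - S s \<omega>))) = laplace t u"
proof -
  have [measurable]: "S s \<in> borel_measurable M" "S t \<in> borel_measurable M" "S 0 \<in> borel_measurable M"
    "S (s + t) \<in> borel_measurable M"
    using assms by (auto intro: measurable_process)
  have "(LINT \<omega>|M. exp (- u * (S (s + t) \<omega> - S s \<omega>))) = (LINT x|distr M borel (\<lambda>\<omega>. S (s + t) \<omega> - S s \<omega>). exp (- u * x))"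
    by (subst integral_distr) auto
  also have "distr M borel (\<lambda>\<omega>. S (s + t) \<omega> - S s \<omega>) = distr M borel (\<lambda>\<omega>. S t \<omega> - S 0 \<omega>)"
    using assms by (intro stationary_increments) auto
  also have "(LINT x|distr M borel (\<lambda>\<omega>. S t \<omega> - S 0 \<omega>). exp (- u * x)) = (LINT \<omega>|M. exp (- u * (S t \<omega> - S 0 \<omega>)))"
    by (subst integral_distr) auto
  also have "\<dots> = laplace t u"
    unfolding laplace_def using AE_zero by (intro integral_cong_AE) (auto elim!: eventually_mono)
  finally show ?thesis .
qed

text \<open>The increments over [0, s] and [s, s + t] are independent; the first is S s almost
  surely, and by stationarity the second has the law of S t.\<close>

lemma laplace_add:
  assumes "0 \<le> s" "0 \<le> t" "0 \<le> u"
  shows "laplace (s + t) u = laplace s u * laplace t u"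
proof -
  define \<tau> where "\<tau> i = (if i = 0 then 0 else if i = 1 then s else s + t)" for i :: nat
  define X where "X i \<omega> = exp (- u * (S (\<tau> (Suc i)) \<omega> - S (\<tau> i) \<omega>))" for i :: nat and \<omega>
  have [measurable]: "S s \<in> borel_measurable M" "S t \<in> borel_measurable M" "S 0 \<in> borel_measurable M"
    "S (s + t) \<in> borel_measurable M"
    using assms by (auto intro: measurable_process)
  have "indep_vars (\<lambda>_. borel) (\<lambda>i \<omega>. S (\<tau> (Suc i)) \<omega> - S (\<tau> i) \<omega>) {..<2}"
    using assms by (intro independent_increments) (auto simp: \<tau>_def)
  then have ind: "indep_vars (\<lambda>_. borel) X {..<2}"
    unfolding X_def by (rule indep_vars_compose2) measurable
  have X0: "AE \<omega> in M. X 0 \<omega> = exp (- u * S s \<omega>)"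
    using AE_zero by (rule eventually_mono) (simp add: X_def \<tau>_def)
  have X1: "X 1 \<omega> = exp (- u * (S (s + t) \<omega> - S s \<omega>))" for \<omega> by (simp add: X_def \<tau>_def)
  have Xm[measurable]: "X 0 \<in> borel_measurable M" "X 1 \<in> borel_measurable M"
    by (simp_all add: X_def[abs_def] \<tau>_def)
  have bnd: "AE \<omega> in M. norm (X i \<omega>) \<le> 1" if "i < 2" for i
    using paths
  proof (rule eventually_mono)
    fix \<omega> assume "S 0 \<omega> = 0 \<and> (\<forall>s t. 0 \<le> s \<and> s \<le> t \<longrightarrow> S s \<omega> \<le> S t \<omega>) \<and> (\<forall>s\<ge>0. ((\<lambda>t. S t \<omega>) \<longlongrightarrow> S s \<omega>) (at_right s))"
    moreover have "0 \<le> \<tau> i" "\<tau> i \<le> \<tau> (Suc i)" using assms by (auto simp: \<tau>_def)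
    ultimately show "norm (X i \<omega>) \<le> 1" using assms by (simp add: X_def)
  qed
  have int: "integrable M (X i)" if "i < 2" for i
  proof -
    have "i = 0 \<or> i = 1" using that by auto
    then have "X i \<in> borel_measurable M" using Xm by auto
    then show ?thesis using bnd[OF that] by (intro integrable_const_bound[where B=1])
  qed
  have "laplace (s + t) u = (LINT \<omega>|M. (\<Prod>i\<in>{..<2}. X i \<omega>))"
    unfolding laplace_def
  proof (rule integral_cong_AE)
    show "AE \<omega> in M. exp (- u * S (s + t) \<omega>) = (\<Prod>i<2. X i \<omega>)"
      using X0 by (rule eventually_mono)
        (simp add: numeral_2_eq_2 X1[unfolded One_nat_def] exp_add[symmetric] algebra_simps)
    show "(\<lambda>\<omega>. \<Prod>i<2. X i \<omega>) \<in> borel_measurable M"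
      using Xm by (simp add: numeral_2_eq_2)
  qed measurable
  also have "\<dots> = (\<Prod>i\<in>{..<2}. LINT \<omega>|M. X i \<omega>)"
    by (rule indep_vars_lebesgue_integral[OF _ ind int]) auto
  also have "\<dots> = (LINT \<omega>|M. X 0 \<omega>) * (LINT \<omega>|M. X 1 \<omega>)" by (simp add: numeral_2_eq_2)
  also have "(LINT \<omega>|M. X 0 \<omega>) = laplace s u"
    unfolding laplace_def using X0 by (intro integral_cong_AE) auto
  also have "(LINT \<omega>|M. X 1 \<omega>) = laplace t u"
    unfolding X1 by (rule laplace_increment) fact+
  finally show ?thesis .
qed

definition exponent :: "real \<Rightarrow> real" where "exponent u = - ln (laplace 1 u)"

text \<open>\<open>- ln (laplace t u)\<close> is additive in t by \<open>laplace_add\<close> and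
  nonnegative because S t is almost surely nonnegative, so it is linear in t with slope
  \<open>exponent u\<close>.\<close>

lemma laplace_eq: "0 \<le> t \<Longrightarrow> 0 \<le> u \<Longrightarrow> laplace t u = exp (- t * exponent u)"
proof -
  assume *: "0 \<le> t" "0 \<le> u"
  have "- ln (laplace t u) = t * (- ln (laplace 1 u))"
  proof (rule additive_nonneg_linear[where g="\<lambda>t. - ln (laplace t u)"])
    show "- ln (laplace (s + t) u) = - ln (laplace s u) + - ln (laplace t u)" if "0 \<le> s" "0 \<le> t" for s t
      using that *(2) laplace_pos by (simp add: laplace_add ln_mult_pos)
    show "0 \<le> - ln (laplace t u)" if "0 \<le> t" for t
      using that *(2) laplace_pos[of t u] laplace_le_1[of t u] by simp
  qed fact
  then have "ln (laplace t u) = - t * exponent u" by (simp add: exponent_def)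
  then show ?thesis using laplace_pos[OF *] by (metis exp_ln)
qed

lemma exponent_laplace: "is_laplace_exponent M S exponent"
  using laplace_eq by (auto simp: is_laplace_exponent_def laplace_def)

lemma exponent_nonneg: "0 \<le> u \<Longrightarrow> 0 \<le> exponent u"
  using laplace_pos[of 1 u] laplace_le_1[of 1 u] by (simp add: exponent_def)

lemma exponent_zero: "exponent 0 = 0"
  by (simp add: exponent_def laplace_def prob_space)

text \<open>Reflects that S 1 is finite: an infinite value with positive probability would leave a
  positive limit. \<open>levy_khintchine_exists\<close> uses this to exclude a constant
  term.\<close>

lemma exponent_tendsto_0: "(\<lambda>n. exponent (inverse (real (Suc n)))) \<longlonglongrightarrow> 0"
proof -
  note [measurable] = measurable_process[of 1, simplified]
  have "(\<lambda>n. LINT \<omega>|M. exp (- inverse (real (Suc n)) * S 1 \<omega>)) \<longlonglongrightarrow> (LINT \<omega>|M. 1)"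
  proof (rule integral_dominated_convergence[where w="\<lambda>_. 1"])
    show "AE \<omega> in M. (\<lambda>n. exp (- inverse (real (Suc n)) * S 1 \<omega>)) \<longlonglongrightarrow> 1"
    proof (rule AE_I2)
      fix \<omega>
      have "(\<lambda>n. exp (- inverse (real (Suc n)) * S 1 \<omega>)) \<longlonglongrightarrow> exp (- 0 * S 1 \<omega>)"
        by (intro tendsto_intros LIMSEQ_inverse_real_of_nat)
      then show "(\<lambda>n. exp (- inverse (real (Suc n)) * S 1 \<omega>)) \<longlonglongrightarrow> 1" by simp
    qed
    show "AE \<omega> in M. norm (exp (- inverse (real (Suc n)) * S 1 \<omega>)) \<le> 1" for n
      using AE_nonneg[of 1] by (auto elim!: eventually_mono)
  qed auto
  then have "(\<lambda>n. laplace 1 (inverse (real (Suc n)))) \<longlonglongrightarrow> 1"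
    by (simp add: laplace_def prob_space)
  then have "(\<lambda>n. - ln (laplace 1 (inverse (real (Suc n))))) \<longlonglongrightarrow> - ln 1"
    by (intro tendsto_intros) auto
  then show ?thesis by (simp add: exponent_def)
qed

text \<open>The transform is that of a point mass, and the transform determines the law. This links
  a vanishing Levy measure to degeneracy.\<close>

lemma AE_eq_of_linear_exponent:
  assumes lin: "\<And>u. 0 \<le> u \<Longrightarrow> exponent u = \<beta> * u" and \<beta>: "0 \<le> \<beta>" and t: "0 \<le> t"
  shows "AE \<omega> in M. S t \<omega> = \<beta> * t"
proof -
  note [measurable] = measurable_process[OF t]
  have "distr M borel (S t) = distr M borel (\<lambda>_. \<beta> * t)"
  proof (rule laplace_unique)
    show "AE x in distr M borel (S t). 0 \<le> x" "AE x in distr M borel (\<lambda>_. \<beta> * t). 0 \<le> x"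
      using AE_nonneg[OF t] \<beta> t by (simp_all add: AE_distr_iff)
    show "(LINT x|distr M borel (S t). exp (- u * x)) = (LINT x|distr M borel (\<lambda>_. \<beta> * t). exp (- u * x))"
      if "0 \<le> u" for u
      using laplace_eq[OF t that] lin[OF that]
      by (simp add: integral_distr laplace_def prob_space mult_ac del: distr_const)
  qed (auto intro!: finite_measure_distr simp del: distr_const)
  moreover have "AE x in distr M borel (\<lambda>_. \<beta> * t). x = \<beta> * t"
    by (simp add: AE_distr_iff del: distr_const)
  ultimately have "AE x in distr M borel (S t). x = \<beta> * t" by (simp only:)
  then show ?thesis by (simp add: AE_distr_iff)
qed

end

section \<open>Existence of the Levy-Khintchine representation\<close>

text \<open>Retraction of the line onto [0, 1]: composed with it, a continuous kernel on [0, 1]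
  becomes a bounded continuous function on the line, as weak convergence wants.\<close>

definition clamp01 :: "real \<Rightarrow> real" where "clamp01 y = max 0 (min 1 y)"

text \<open>
  The kernel \<open>(1 - exp (- u * x)) / (1 - exp (- x))\<close> in the variable \<open>y = exp (- x)\<close>, extended
  continuously to \<open>y = 1\<close> (that is, \<open>x = 0\<close>) and \<open>y = 0\<close> (that is, \<open>x = \<infinity>\<close>).
\<close>

definition lk_kernel :: "real \<Rightarrow> real \<Rightarrow> real" where
  "lk_kernel u y = (if y = 1 then u else (1 - y powr u) / (1 - y))"

lemma clamp01_bounds [simp]: "0 \<le> clamp01 y" "clamp01 y \<le> 1" by (auto simp: clamp01_def)
lemma clamp01_id: "0 \<le> y \<Longrightarrow> y \<le> 1 \<Longrightarrow> clamp01 y = y" by (auto simp: clamp01_def)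

lemma lk_kernel_cancel: "lk_kernel u y * (1 - y) = 1 - y powr u"
  by (simp add: lk_kernel_def)

text \<open>Away from y = 1 the kernel is the difference quotient of \<open>y powr u\<close> at 1,
  whose limit is the derivative u; this dictates the value u in \<open>lk_kernel\<close>. At y = 0
  positivity of u makes \<open>y powr u\<close> continuous.\<close>

lemma continuous_lk_kernel:
  assumes u: "0 < u"
  shows "continuous_on {0..1} (lk_kernel u)"
  unfolding continuous_on_def
proof
  fix y :: real assume y: "y \<in> {0..1}"
  show "(lk_kernel u \<longlongrightarrow> lk_kernel u y) (at y within {0..1})"
  proof (cases "y = 1")
    case True
    have "((\<lambda>y. y powr u) has_real_derivative u * 1 powr (u - 1)) (at 1)"
      by (rule has_real_derivative_powr) simp
    then have "((\<lambda>y. (y powr u - 1) / (y - 1)) \<longlongrightarrow> u) (at 1)"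
      by (simp add: has_field_derivative_iff)
    then have "((\<lambda>y. (y powr u - 1) / (y - 1)) \<longlongrightarrow> u) (at 1 within {0..1})"
      by (rule tendsto_within_subset) simp
    moreover have "eventually (\<lambda>y. (y powr u - 1) / (y - 1) = lk_kernel u y) (at 1 within {0..1})"
      unfolding eventually_at_filter
      by (intro always_eventually) (auto simp: lk_kernel_def divide_simps algebra_simps)
    ultimately have "(lk_kernel u \<longlongrightarrow> u) (at 1 within {0..1})"
      by (rule Lim_transform_eventually)
    then show ?thesis by (simp add: True lk_kernel_def)
  next
    case False
    have "continuous_on {0..1} (\<lambda>y. y powr u)"
      using u by (intro continuous_on_powr') (auto intro!: continuous_intros)
    then have "((\<lambda>y. y powr u) \<longlongrightarrow> y powr u) (at y within {0..1})"
      using y by (simp add: continuous_on_def)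
    then have "((\<lambda>y. (1 - y powr u) / (1 - y)) \<longlongrightarrow> (1 - y powr u) / (1 - y)) (at y within {0..1})"
      using False by (intro tendsto_divide tendsto_diff tendsto_const tendsto_ident_at) auto
    moreover have "eventually (\<lambda>x. (1 - x powr u) / (1 - x) = lk_kernel u x) (at y within {0..1})"
    proof -
      have "eventually (\<lambda>x. x \<noteq> 1) (at y within {0..1})"
        using False by (intro tendsto_imp_eventually_ne[OF tendsto_ident_at]) auto
      then show ?thesis by (rule eventually_mono) (simp add: lk_kernel_def)
    qed
    ultimately have "(lk_kernel u \<longlongrightarrow> (1 - y powr u) / (1 - y)) (at y within {0..1})"
      by (rule Lim_transform_eventually)
    then show ?thesis using False by (simp add: lk_kernel_def)
  qed
qed

lemma continuous_lk_kernel_clamp: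
  assumes "0 < u"
  shows "continuous_on UNIV (\<lambda>y. lk_kernel u (clamp01 y))"
proof -
  have "continuous_on UNIV clamp01" unfolding clamp01_def[abs_def] by (intro continuous_intros)
  moreover have "clamp01 ` UNIV \<subseteq> {0..1}" by auto
  ultimately show ?thesis
    using continuous_on_compose2[OF continuous_lk_kernel[OF assms]] by blast
qed

lemma lk_kernel_clamp_bounded:
  assumes "0 < u"
  shows "\<exists>B. \<forall>y. norm (lk_kernel u (clamp01 y)) \<le> B"
proof -
  have "compact (lk_kernel u ` {0..1})"
    by (intro compact_continuous_image continuous_lk_kernel assms) auto
  then have "bounded (lk_kernel u ` {0..1})" by (rule compact_imp_bounded)
  then obtain B where B: "\<forall>z\<in>lk_kernel u ` {0..1}. norm z \<le> B"
    unfolding bounded_iff by (rule exE)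
  have "norm (lk_kernel u (clamp01 y)) \<le> B" for y
    by (rule bspec[OF B]) simp
  then show ?thesis by (intro exI allI)
qed

context nondegenerate_subordinator
begin

text \<open>Allows normalisation by \<open>exponent 1\<close>. If it were 0, the almost surely
  nonnegative variable \<open>1 - exp (- S t)\<close> would have mean 0, and S t would be 0 almost
  surely at the very time where it is not constant.\<close>

lemma exponent_pos: "0 < exponent 1"
proof (rule ccontr)
  assume "\<not> 0 < exponent 1"
  then have e: "exponent 1 = 0" using exponent_nonneg[of 1] by simp
  obtain t where t: "0 < t" and nd: "\<not> (\<exists>c. AE \<omega> in M. S t \<omega> = c)"
    using nondegenerate by blast
  note [measurable] = measurable_process[of t]
  have int: "integrable M (\<lambda>\<omega>. exp (- 1 * S t \<omega>))" using t by (intro integrable_laplace) auto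
  have "laplace t 1 = 1" using laplace_eq[of t 1] t e by simp
  then have "(LINT \<omega>|M. 1 - exp (- 1 * S t \<omega>)) = 0"
    using int by (simp add: laplace_def prob_space)
  moreover have "AE \<omega> in M. 0 \<le> 1 - exp (- 1 * S t \<omega>)"
    using AE_nonneg[of t] t by (auto elim!: eventually_mono)
  ultimately have "AE \<omega> in M. 1 - exp (- 1 * S t \<omega>) = 0"
    using int by (subst (asm) integral_nonneg_eq_0_iff_AE) auto
  then have "AE \<omega> in M. S t \<omega> = 0" by (auto elim!: eventually_mono)
  with nd show False by blast
qed

text \<open>
  As \<open>h\<close> tends to 0 a limit point on \<open>[0, 1]\<close> encodes \<open>(1 - exp (- x)) \<Lambda>(dx)\<close> together with the drift as an atom at 1.
\<close>

definition tilted :: "real \<Rightarrow> real measure" where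
  "tilted h = distr (density M (\<lambda>\<omega>. ennreal ((1 - exp (- S h \<omega>)) / (1 - laplace h 1)))) borel (\<lambda>\<omega>. exp (- S h \<omega>))"

lemma laplace_less_1: "0 < h \<Longrightarrow> laplace h 1 < 1"
  using exponent_pos by (simp add: laplace_eq)

lemma integral_tilted:
  assumes h: "0 < h" and f: "f \<in> borel_measurable borel"
  shows "(LINT y|tilted h. f y) = (LINT \<omega>|M. (1 - exp (- S h \<omega>)) * f (exp (- S h \<omega>))) / (1 - laplace h 1)"
proof -
  note [measurable] = f measurable_process[OF less_imp_le[OF h]]
  have nn: "AE \<omega> in M. 0 \<le> (1 - exp (- S h \<omega>)) / (1 - laplace h 1)"
    using AE_nonneg[OF less_imp_le[OF h]] laplace_less_1[OF h] by (auto elim!: eventually_mono)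
  have "(LINT y|tilted h. f y) = (LINT \<omega>|M. ((1 - exp (- S h \<omega>)) / (1 - laplace h 1)) *\<^sub>R f (exp (- S h \<omega>)))"
  proof -
    have "(LINT y|tilted h. f y) = (LINT \<omega>|density M (\<lambda>\<omega>. ennreal ((1 - exp (- S h \<omega>)) / (1 - laplace h 1))). f (exp (- S h \<omega>)))"
      unfolding tilted_def by (rule integral_distr) measurable
    also have "\<dots> = (LINT \<omega>|M. ((1 - exp (- S h \<omega>)) / (1 - laplace h 1)) *\<^sub>R f (exp (- S h \<omega>)))"
      by (rule integral_density[OF _ _ nn]) measurable
    finally show ?thesis .
  qed
  also have "\<dots> = (LINT \<omega>|M. (1 - exp (- S h \<omega>)) * f (exp (- S h \<omega>)) / (1 - laplace h 1))"
    by (intro Bochner_Integration.integral_cong) auto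
  finally show ?thesis by simp
qed

lemma tilted_distribution:
  assumes h: "0 < h"
  shows "real_distribution (tilted h)" and "AE y in tilted h. 0 \<le> y \<and> y \<le> 1"
proof -
  note [measurable] = measurable_process[OF less_imp_le[OF h]]
  have nn: "AE \<omega> in M. 0 \<le> (1 - exp (- S h \<omega>)) / (1 - laplace h 1)"
    using AE_nonneg[OF less_imp_le[OF h]] laplace_less_1[OF h] by (auto elim!: eventually_mono)
  have int: "integrable M (\<lambda>\<omega>. (1 - exp (- 1 * S h \<omega>)) / (1 - laplace h 1))"
    using h by (intro integrable_divide Bochner_Integration.integrable_diff integrable_laplace) auto
  have "(\<integral>\<^sup>+\<omega>. ennreal ((1 - exp (- S h \<omega>)) / (1 - laplace h 1)) \<partial>M)
      = ennreal (LINT \<omega>|M. (1 - exp (- S h \<omega>)) / (1 - laplace h 1))"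
    using int nn by (intro nn_integral_eq_integral) auto
  also have "(LINT \<omega>|M. (1 - exp (- S h \<omega>)) / (1 - laplace h 1)) = 1"
    using integrable_laplace[of h 1] h laplace_less_1[OF h]
    by (simp add: laplace_def prob_space)
  finally have "prob_space (density M (\<lambda>\<omega>. ennreal ((1 - exp (- S h \<omega>)) / (1 - laplace h 1))))"
    by (intro prob_spaceI) (simp add: emeasure_density cong: nn_integral_cong)
  then have "prob_space (tilted h)"
    unfolding tilted_def by (rule prob_space.prob_space_distr) simp
  then show "real_distribution (tilted h)"
    by (intro real_distribution.intro real_distribution_axioms.intro) (auto simp: tilted_def)
  show "AE y in tilted h. 0 \<le> y \<and> y \<le> 1"
    unfolding tilted_def using AE_nonneg[OF less_imp_le[OF h]]
    by (subst AE_distr_iff) (auto simp: AE_density elim!: eventually_mono)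
qed

text \<open>The factor 1 - y of the tilt cancels the denominator of the kernel, leaving
  \<open>1 - y powr u\<close> at y = exp (- S h).\<close>

lemma integral_tilted_kernel:
  assumes h: "0 < h" and u: "0 < u"
  shows "(LINT y|tilted h. lk_kernel u (clamp01 y)) = (1 - laplace h u) / (1 - laplace h 1)"
proof -
  note [measurable] = measurable_process[OF less_imp_le[OF h]]
  have k[measurable]: "(\<lambda>y. lk_kernel u (clamp01 y)) \<in> borel_measurable borel"
    using continuous_lk_kernel_clamp[OF u] by (rule borel_measurable_continuous_onI)
  have "(LINT \<omega>|M. (1 - exp (- S h \<omega>)) * lk_kernel u (clamp01 (exp (- S h \<omega>)))) = (LINT \<omega>|M. 1 - exp (- u * S h \<omega>))"
  proof (rule integral_cong_AE)
    show "AE \<omega> in M. (1 - exp (- S h \<omega>)) * lk_kernel u (clamp01 (exp (- S h \<omega>))) = 1 - exp (- u * S h \<omega>)"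
      using AE_nonneg[OF less_imp_le[OF h]]
    proof eventually_elim
      case (elim \<omega>)
      have "(1 - exp (- S h \<omega>)) * lk_kernel u (clamp01 (exp (- S h \<omega>))) = 1 - exp (- S h \<omega>) powr u"
        using elim lk_kernel_cancel[of u "exp (- S h \<omega>)"] by (simp add: clamp01_id mult.commute)
      also have "exp (- S h \<omega>) powr u = exp (- u * S h \<omega>)" by (simp add: powr_def)
      finally show ?case .
    qed
  qed measurable
  also have "\<dots> = 1 - laplace h u"
    using integrable_laplace[of h u] h u by (simp add: laplace_def prob_space)
  finally show ?thesis by (simp add: integral_tilted[OF h k])
qed

text \<open>Divided by h, numerator and denominator are, up to sign, difference quotients of
  \<open>exp (- t * exponent v)\<close> at t = 0, with v = u and v = 1.\<close>

lemma tilted_kernel_limit: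
  assumes u: "0 < u"
  shows "(\<lambda>n. LINT y|tilted (inverse (real (Suc n))). lk_kernel u (clamp01 y)) \<longlonglongrightarrow> exponent u / exponent 1"
proof -
  define h where "h n = inverse (real (Suc n))" for n
  have h: "0 < h n" for n by (simp add: h_def)
  have lim: "(\<lambda>n. (1 - laplace (h n) v) / h n) \<longlonglongrightarrow> exponent v" if v: "0 \<le> v" for v
  proof -
    have "((\<lambda>t. exp (- t * exponent v)) has_real_derivative - exponent v) (at 0)"
      by (auto intro!: derivative_eq_intros)
    then have "((\<lambda>t. (exp (- t * exponent v) - 1) / t) \<longlongrightarrow> - exponent v) (at 0)"
      by (simp add: has_field_derivative_iff)
    moreover have "filterlim h (at 0) sequentially"
      using LIMSEQ_inverse_real_of_nat h unfolding filterlim_at h_def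
      by (auto intro!: always_eventually)
    ultimately have "(\<lambda>n. (exp (- h n * exponent v) - 1) / h n) \<longlonglongrightarrow> - exponent v"
      by (rule filterlim_compose)
    then have "(\<lambda>n. - ((exp (- h n * exponent v) - 1) / h n)) \<longlonglongrightarrow> - (- exponent v)"
      by (rule tendsto_minus)
    moreover have "- ((exp (- h n * exponent v) - 1) / h n) = (1 - laplace (h n) v) / h n" for n
      using laplace_eq[of "h n" v] h[of n] v by (simp add: minus_divide_left)
    ultimately show ?thesis by simp
  qed
  have "(\<lambda>n. ((1 - laplace (h n) u) / h n) / ((1 - laplace (h n) 1) / h n)) \<longlonglongrightarrow> exponent u / exponent 1"
    using u exponent_pos by (intro tendsto_divide lim) auto
  moreover have "((1 - laplace (h n) u) / h n) / ((1 - laplace (h n) 1) / h n)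
      = (LINT y|tilted (h n). lk_kernel u (clamp01 y))" for n
    using h[of n] by (simp add: integral_tilted_kernel u)
  ultimately show ?thesis by (simp add: h_def)
qed

text \<open>A weakly convergent subsequence suffices: the integrals of the kernel converge along the
  full sequence, so the subsequence inherits their limit.\<close>

lemma tilted_limit:
  "\<exists>\<sigma>. real_distribution \<sigma> \<and>
    (\<forall>u>0. (LINT y|\<sigma>. lk_kernel u (clamp01 y)) = exponent u / exponent 1)"
proof -
  define \<mu> where "\<mu> n = tilted (inverse (real (Suc n)))" for n
  have \<mu>: "real_distribution (\<mu> n)" "AE y in \<mu> n. 0 \<le> y \<and> y \<le> 1" for n
    unfolding \<mu>_def by (rule tilted_distribution; simp)+
  have "tight \<mu>"
    unfolding tight_def
  proof (intro conjI allI impI \<mu>)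
    fix \<epsilon> :: real assume \<epsilon>: "0 < \<epsilon>"
    \<comment> \<open>Tightness is phrased with intervals open on the left; the left end -1 keeps
      the point 0 inside.\<close>
    have "1 - \<epsilon> < measure (\<mu> n) {-1<..1}" for n
    proof -
      interpret \<mu>n: real_distribution "\<mu> n" by (rule \<mu>)
      have "\<mu>n.prob {-1<..1} = 1"
        using \<mu>(2)[of n] by (intro \<mu>n.prob_eq_1[THEN iffD2]) (auto elim!: eventually_mono)
      then show ?thesis using \<epsilon> by simp
    qed
    then show "\<exists>a b. a < b \<and> (\<forall>n. 1 - \<epsilon> < measure (\<mu> n) {a<..b})"
      by (intro exI[of _ "-1"] exI[of _ 1]) auto
  qed
  from tight_imp_convergent_subsubsequence[OF this strict_mono_id] obtain r \<sigma> where
    r: "strict_mono r" and \<sigma>: "real_distribution \<sigma>" and conv: "weak_conv_m (\<mu> \<circ> r) \<sigma>"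
    by (auto simp: comp_def)
  show ?thesis
  proof (intro exI[of _ \<sigma>] conjI allI impI \<sigma>)
    fix u :: real assume u: "0 < u"
    obtain B where B: "\<And>y. norm (lk_kernel u (clamp01 y)) \<le> B"
      using lk_kernel_clamp_bounded[OF u] by auto
    have "(\<lambda>n. LINT y|(\<mu> \<circ> r) n. lk_kernel u (clamp01 y)) \<longlonglongrightarrow> (LINT y|\<sigma>. lk_kernel u (clamp01 y))"
    proof (rule weak_conv_imp_integral_bdd_continuous_conv[OF _ \<sigma> conv])
      show "real_distribution ((\<mu> \<circ> r) n)" for n using \<mu> by simp
      show "isCont (\<lambda>y. lk_kernel u (clamp01 y)) x" for x
        using continuous_lk_kernel_clamp[OF u] by (simp add: continuous_on_eq_continuous_at)
    qed (rule B)
    moreover have "(\<lambda>n. LINT y|(\<mu> \<circ> r) n. lk_kernel u (clamp01 y)) \<longlonglongrightarrow> exponent u / exponent 1"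
      using LIMSEQ_subseq_LIMSEQ[OF tilted_kernel_limit[OF u] r] by (simp add: \<mu>_def comp_def)
    ultimately show "(LINT y|\<sigma>. lk_kernel u (clamp01 y)) = exponent u / exponent 1"
      by (rule LIMSEQ_unique)
  qed
qed

text \<open>The parts of the limit law on y \<ge> 1, 0 < y < 1 and y \<le> 0 yield the drift, the
  Levy measure and a constant term, which must vanish.\<close>

lemma levy_khintchine_exists:
  "\<exists>\<beta> \<Lambda>. 0 \<le> \<beta> \<and> levy_measure \<Lambda> \<and> (\<forall>u\<ge>0. exponent u = levy_khintchine \<beta> \<Lambda> u)"
proof -
  obtain \<sigma> where \<sigma>: "real_distribution \<sigma>"
    and lim: "\<And>u. 0 < u \<Longrightarrow> (LINT y|\<sigma>. lk_kernel u (clamp01 y)) = exponent u / exponent 1"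
    using tilted_limit by auto
  interpret \<sigma>: real_distribution \<sigma> by (rule \<sigma>)
  \<comment> \<open>The integrals against the limit law carry the divisor \<open>exponent 1\<close>;
    the factor c removes it.\<close>
  define c where "c = exponent 1"
  have c: "0 < c" using exponent_pos by (simp add: c_def)
  \<comment> \<open>The clamped kernel equals u on all of y \<ge> 1 and 1 on all of y \<le> 0, so
    these half-lines stand in for the two end points of [0, 1].\<close>
  define \<beta> where "\<beta> = c * measure \<sigma> {1..}"
  define \<kappa> where "\<kappa> = c * measure \<sigma> {..0}"
  \<comment> \<open>Divides out the factor 1 - y of the tilt on the open interval.\<close>
  define w where "w y = indicator {0<..<1} y * (c / (1 - y))" for y :: real
  \<comment> \<open>Returns from y to x = - ln y. Outside (0, 1), where w vanishes, the value 1 only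
    keeps T inside the half-line.\<close>
  define T where "T y = (if 0 < y \<and> y < 1 then - ln y else 1)" for y :: real
  let ?H = "restrict_space borel {0 :: real<..}"
  define \<Lambda> where "\<Lambda> = distr (density \<sigma> (\<lambda>y. ennreal (w y))) ?H T"
  have w0: "0 \<le> w y" for y using c by (auto simp: w_def indicator_def)
  have [measurable]: "w \<in> borel_measurable borel" unfolding w_def[abs_def] by measurable
  have [measurable]: "T \<in> borel_measurable borel" unfolding T_def[abs_def] by measurable
  then have [measurable]: "T \<in> measurable borel ?H"
    by (intro measurable_restrict_space2) (auto simp: T_def)
  have k_meas[measurable]: "(\<lambda>x. 1 - exp (- u * x)) \<in> borel_measurable ?H" for u :: real
    by (rule measurable_restrict_space1) measurable
  have halfline: "halfline_measure \<Lambda>" by (simp add: halfline_measure_def \<Lambda>_def)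
  have kernel: "w y * (1 - exp (- u * T y)) =
      c * lk_kernel u (clamp01 y) - c * u * indicator {1..} y - c * indicator {..0} y" if u: "0 < u" for u y
  proof -
    consider "y \<le> 0" | "1 \<le> y" | "0 < y" "y < 1" by linarith
    then show ?thesis
    proof cases
      case 3
      then have "exp (- u * T y) = y powr u" by (simp add: T_def powr_def)
      then show ?thesis using 3 by (simp add: w_def clamp01_id lk_kernel_def)
    qed (use u in \<open>auto simp: w_def clamp01_def lk_kernel_def\<close>)
  qed
  have ker_int: "integrable \<sigma> (\<lambda>y. lk_kernel u (clamp01 y))" if u: "0 < u" for u
  proof -
    obtain B where "\<And>y. norm (lk_kernel u (clamp01 y)) \<le> B"
      using lk_kernel_clamp_bounded[OF u] by auto
    moreover have "(\<lambda>y. lk_kernel u (clamp01 y)) \<in> borel_measurable borel"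
      using continuous_lk_kernel_clamp[OF u] by (rule borel_measurable_continuous_onI)
    ultimately show ?thesis by (intro \<sigma>.integrable_const_bound[where B=B]) auto
  qed
  have ind: "integrable \<sigma> (indicator A :: real \<Rightarrow> real)" if "A \<in> sets borel" for A
    using that by (intro integrable_real_indicator) (auto simp: less_top[symmetric])
  have ker_int': "integrable \<sigma> (\<lambda>y. c * lk_kernel u (clamp01 y))"
    "integrable \<sigma> (\<lambda>y. c * u * indicator {1..} y)" "integrable \<sigma> (\<lambda>y. c * indicator {..0} y)"
    if u: "0 < u" for u
    using ker_int[OF u] ind by (intro integrable_mult_right; simp)+
  have int: "integrable \<Lambda> (\<lambda>x. 1 - exp (- u * x))" if u: "0 < u" for u
  proof -
    have "integrable \<sigma> (\<lambda>y. w y *\<^sub>R (1 - exp (- u * T y)))"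
      unfolding real_scaleR_def kernel[OF u] by (intro Bochner_Integration.integrable_diff ker_int'[OF u])
    then have "integrable (density \<sigma> (\<lambda>y. ennreal (w y))) (\<lambda>y. 1 - exp (- u * T y))"
      by (subst integrable_density) (auto simp: w0)
    then show ?thesis unfolding \<Lambda>_def by (subst integrable_distr_eq[OF _ k_meas]) simp_all
  qed
  have eq: "exponent u = \<beta> * u + \<kappa> + (LINT x|\<Lambda>. 1 - exp (- u * x))" if u: "0 < u" for u
  proof -
    have "(LINT x|\<Lambda>. 1 - exp (- u * x)) = (LINT y|density \<sigma> (\<lambda>y. ennreal (w y)). 1 - exp (- u * T y))"
      unfolding \<Lambda>_def by (rule integral_distr[OF _ k_meas]) simp
    also have "\<dots> = (LINT y|\<sigma>. w y *\<^sub>R (1 - exp (- u * T y)))"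
      by (rule integral_density) (auto simp: w0)
    also have "\<dots> = c * (LINT y|\<sigma>. lk_kernel u (clamp01 y)) - c * u * measure \<sigma> {1..} - c * measure \<sigma> {..0}"
      unfolding real_scaleR_def kernel[OF u]
      using ker_int'[OF u] Bochner_Integration.integrable_diff[OF ker_int'(1,2)[OF u]] by simp
    also have "c * (LINT y|\<sigma>. lk_kernel u (clamp01 y)) = exponent u"
      using lim[OF u] c by (simp add: c_def)
    finally show ?thesis by (simp add: \<beta>_def \<kappa>_def mult_ac)
  qed
  have levy: "levy_measure \<Lambda>"
    unfolding levy_measure_def using halfline int[of 1] zero_less_one by blast
  have \<beta>: "0 \<le> \<beta>" using c by (simp add: \<beta>_def)
  \<comment> \<open>The constant \<kappa> would be a killing rate. It lies below the exponent at
    every u > 0, and the exponent tends to 0 along u = 1/(n + 1).\<close>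
  have "\<kappa> \<le> exponent u" if u: "0 < u" for u
  proof -
    have "0 \<le> (LINT x|\<Lambda>. 1 - exp (- u * x))"
      using u halfline_measure_space[OF halfline] by (intro integral_nonneg_AE AE_I2) auto
    moreover have "0 \<le> \<beta> * u" using \<beta> u by simp
    ultimately show ?thesis using eq[OF u] by linarith
  qed
  then have "\<kappa> \<le> 0"
    by (intro LIMSEQ_le_const[OF exponent_tendsto_0]) auto
  then have "\<kappa> = 0" using c by (simp add: \<kappa>_def measure_nonneg mult_le_0_iff order_antisym)
  then have "exponent u = levy_khintchine \<beta> \<Lambda> u" if "0 \<le> u" for u
    using eq[of u] that exponent_zero by (cases "u = 0") (auto simp: levy_khintchine_def)
  with \<beta> levy show ?thesis by (intro exI[of _ \<beta>] exI[of _ \<Lambda>] conjI allI impI)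
qed

end

section \<open>Nondegeneracy and nonzero Levy measures\<close>

lemma is_laplace_exponent_unique:
  assumes "is_laplace_exponent M S \<Psi>" "is_laplace_exponent M S \<Psi>'" "0 \<le> u"
  shows "\<Psi> u = \<Psi>' u"
proof -
  have "exp (- 1 * \<Psi> u) = exp (- 1 * \<Psi>' u)"
    using assms unfolding is_laplace_exponent_def by (metis zero_le_one)
  then show ?thesis by simp
qed

text \<open>The Levy measure of a deterministic line, the competitor to which
  \<open>nondegenerateI\<close> applies uniqueness.\<close>

lemma levy_measure_null: "levy_measure (null_measure (restrict_space borel {0<..}))"
proof -
  let ?N = "null_measure (restrict_space borel {0 :: real<..})"
  have N: "halfline_measure ?N" by (simp add: halfline_measure_def)
  have "(\<lambda>x. 1 - exp (- 1 * x) :: real) \<in> borel_measurable ?N"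
    by (rule halfline_measure_measurable[OF N]) measurable
  then have "integrable ?N (\<lambda>x. 1 - exp (- 1 * x) :: real)"
    by (simp add: integrable_iff_bounded)
  with N show ?thesis unfolding levy_measure_def using zero_less_one by blast
qed

text \<open>If S 1 were a constant c, its exponent would be \<open>c * u\<close>, the one with drift
  c and null Levy measure; uniqueness of the representation would then force \<Lambda> to
  vanish.\<close>

lemma nondegenerateI:
  assumes S: "subordinator M S" and \<Psi>: "is_laplace_exponent M S (levy_khintchine \<beta> \<Lambda>)"
    and L: "levy_measure \<Lambda>" and nz: "emeasure \<Lambda> {0<..} \<noteq> 0"
  shows "nondegenerate_subordinator M S"
proof -
  interpret subordinator M S by fact
  have "\<not> (\<exists>c. AE \<omega> in M. S 1 \<omega> = c)"
  proof
    assume "\<exists>c. AE \<omega> in M. S 1 \<omega> = c"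
    then obtain c where c: "AE \<omega> in M. S 1 \<omega> = c" by blast
    note [measurable] = measurable_process[of 1, simplified]
    let ?N = "null_measure (restrict_space borel {0 :: real<..})"
    have "levy_khintchine \<beta> \<Lambda> u = levy_khintchine c ?N u" if u: "0 \<le> u" for u
    proof -
      have "exp (- 1 * levy_khintchine \<beta> \<Lambda> u) = (LINT \<omega>|M. exp (- u * S 1 \<omega>))"
        using \<Psi> u by (simp add: is_laplace_exponent_def)
      also have "\<dots> = (LINT \<omega>|M. exp (- u * c))"
        using c by (intro integral_cong_AE) (auto elim!: eventually_mono)
      finally have "levy_khintchine \<beta> \<Lambda> u = u * c" by (simp add: prob_space)
      then show ?thesis by (simp add: levy_khintchine_def[of c] mult.commute)
    qed
    then have "\<Lambda> = ?N" by (rule levy_khintchine_unique(2)[OF L levy_measure_null])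
    with nz show False by simp
  qed
  then show ?thesis
    by (intro nondegenerate_subordinator.intro nondegenerate_subordinator_axioms.intro S)
      (auto intro!: exI[of _ 1])
qed

text \<open>Without jumps the exponent is linear, which makes every S t with t > 0 constant almost
  surely, against nondegeneracy.\<close>

lemma (in nondegenerate_subordinator) levy_measure_nonzero:
  assumes L: "levy_measure \<Lambda>" and \<beta>: "0 \<le> \<beta>"
    and eq: "\<And>u. 0 \<le> u \<Longrightarrow> exponent u = levy_khintchine \<beta> \<Lambda> u"
  shows "emeasure \<Lambda> {0<..} \<noteq> 0"
proof
  assume "emeasure \<Lambda> {0<..} = 0"
  then have null: "AE x in \<Lambda>. False"
    using halfline_measure_space[OF levy_measureD(1)[OF L]] sets.top[of \<Lambda>]
    by (intro AE_I[of _ _ "{0<..}"]) auto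
  have "(LINT x|\<Lambda>. 1 - exp (- u * x)) = 0" for u
    by (intro integral_eq_zero_AE eventually_mono[OF null]) simp
  then have "exponent u = \<beta> * u" if "0 \<le> u" for u
    using eq[OF that] by (simp add: levy_khintchine_def)
  then have "\<forall>t>0. AE \<omega> in M. S t \<omega> = \<beta> * t" using AE_eq_of_linear_exponent \<beta> by auto
  with nondegenerate show False by blast
qed

theorem mainTheorem1:
  shows
    "(\<forall>\<Lambda>. halfline_measure \<Lambda> \<longrightarrow>
        ((\<exists>u>0. integrable \<Lambda> (\<lambda>x. 1 - exp (- u * x))) \<longleftrightarrow>
         (\<forall>u>0. integrable \<Lambda> (\<lambda>x. 1 - exp (- u * x)))) \<and>
        ((\<exists>u>0. integrable \<Lambda> (\<lambda>x. 1 - exp (- u * x))) \<longleftrightarrow>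
         integrable \<Lambda> (\<lambda>x. min x 1)))
     \<and>
     (\<forall>\<beta> \<Lambda>. 0 \<le> \<beta> \<and> levy_measure \<Lambda> \<and> emeasure \<Lambda> {0<..} \<noteq> 0 \<longrightarrow>
        (\<exists>(M :: (real \<Rightarrow> real) measure) S.
           nondegenerate_subordinator M S \<and>
           is_laplace_exponent M S (levy_khintchine \<beta> \<Lambda>)))
     \<and>
     (\<forall>(M :: 'a measure) S. nondegenerate_subordinator M S \<longrightarrow>
        (\<exists>\<beta> \<Lambda>. 0 \<le> \<beta> \<and> levy_measure \<Lambda> \<and> emeasure \<Lambda> {0<..} \<noteq> 0 \<and>
           is_laplace_exponent M S (levy_khintchine \<beta> \<Lambda>) \<and>
           (\<forall>\<beta>' \<Lambda>'. 0 \<le> \<beta>' \<and> levy_measure \<Lambda>' \<and>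
              is_laplace_exponent M S (levy_khintchine \<beta>' \<Lambda>') \<longrightarrow> \<beta>' = \<beta> \<and> \<Lambda>' = \<Lambda>)))"
proof (intro conjI allI impI)
  fix \<Lambda> :: "real measure" assume "halfline_measure \<Lambda>"
  note iff = integrable_one_minus_exp_iff[OF this]
  show "(\<exists>u>0. integrable \<Lambda> (\<lambda>x. 1 - exp (- u * x))) \<longleftrightarrow> (\<forall>u>0. integrable \<Lambda> (\<lambda>x. 1 - exp (- u * x)))"
    using iff zero_less_one by metis
  show "(\<exists>u>0. integrable \<Lambda> (\<lambda>x. 1 - exp (- u * x))) \<longleftrightarrow> integrable \<Lambda> (\<lambda>x. min x 1)"
    using iff zero_less_one by metis
next
  fix \<beta> :: real and \<Lambda> :: "real measure" assume *: "0 \<le> \<beta> \<and> levy_measure \<Lambda> \<and> emeasure \<Lambda> {0<..} \<noteq> 0"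
  show "\<exists>(M :: (real \<Rightarrow> real) measure) S.
      nondegenerate_subordinator M S \<and> is_laplace_exponent M S (levy_khintchine \<beta> \<Lambda>)"
  proof (rule subordinator_exists[of \<beta> \<Lambda>])
    show "0 \<le> \<beta>" "levy_measure \<Lambda>" using * by simp_all
    fix M :: "(real \<Rightarrow> real) measure" and S
    assume S: "subordinator M S" and \<Psi>: "is_laplace_exponent M S (levy_khintchine \<beta> \<Lambda>)"
    have "nondegenerate_subordinator M S" using nondegenerateI[OF S \<Psi>] * by simp
    with \<Psi> show ?thesis by (intro exI[of _ M] exI[of _ S] conjI)
  qed
next
  fix M :: "'a measure" and S assume "nondegenerate_subordinator M S"
  then interpret nondegenerate_subordinator M S .
  obtain \<beta> \<Lambda> where \<beta>: "0 \<le> \<beta>" and L: "levy_measure \<Lambda>"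
    and eq: "\<And>u. 0 \<le> u \<Longrightarrow> exponent u = levy_khintchine \<beta> \<Lambda> u"
    using levy_khintchine_exists by auto
  have \<Psi>: "is_laplace_exponent M S (levy_khintchine \<beta> \<Lambda>)"
    using exponent_laplace eq by (simp add: is_laplace_exponent_def)
  show "\<exists>\<beta> \<Lambda>. 0 \<le> \<beta> \<and> levy_measure \<Lambda> \<and> emeasure \<Lambda> {0<..} \<noteq> 0 \<and>
           is_laplace_exponent M S (levy_khintchine \<beta> \<Lambda>) \<and>
           (\<forall>\<beta>' \<Lambda>'. 0 \<le> \<beta>' \<and> levy_measure \<Lambda>' \<and>
              is_laplace_exponent M S (levy_khintchine \<beta>' \<Lambda>') \<longrightarrow> \<beta>' = \<beta> \<and> \<Lambda>' = \<Lambda>)"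
  proof (intro exI[of _ \<beta>] exI[of _ \<Lambda>] conjI allI impI \<beta> L \<Psi>)
    show "emeasure \<Lambda> {0<..} \<noteq> 0" by (rule levy_measure_nonzero[OF L \<beta> eq])
    fix \<beta>' \<Lambda>'
    assume *: "0 \<le> \<beta>' \<and> levy_measure \<Lambda>' \<and> is_laplace_exponent M S (levy_khintchine \<beta>' \<Lambda>')"
    then have L': "levy_measure \<Lambda>'" and \<Psi>': "is_laplace_exponent M S (levy_khintchine \<beta>' \<Lambda>')"
      by simp_all
    note unique = levy_khintchine_unique[OF L' L is_laplace_exponent_unique[OF \<Psi>' \<Psi>]]
    show "\<beta>' = \<beta>" by (rule unique(1))
    show "\<Lambda>' = \<Lambda>" by (rule unique(2))
  qed
qed

end
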